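(* In the setting described in the context, with $f\equiv0$, assume conditions (j) and (jj). Assume there is $\overline T>0$ such that for every $T>\overline T$ there is a constant $c>0$ (depending on $T$, not on the data) with $$\tfrac12\big(\|w_0\|_V^2+\|w_1\|_H^2\big)\le c\int_0^T\|w_t(s)\|_{W_1}^2\,ds$$ for every weak solution $w$ of $w_{tt}+Aw=0$, $w(0)=w_0\in V$, $w_t(0)=w_1\in H$; and that $T^*:=\inf_nT_{2n}>\overline T$. Let $c$ be the constant corresponding to $T=T^*$, and $$\hat c_n=\frac{2c(1+4C_1^2T_{2n}^2M_{2n}^2)}{m_{2n}+2c(1+4C_1^2T_{2n}^2M_{2n}^2)}.$$ If $$\sum_{n=0}^\infty\big[2C_3M_{2n+1}T_{2n+1}+\ln\hat c_n\big]=-\infty,$$ then every solution $u$ of $u_{tt}(t)+Au(t)+B_1(t)B_1^*(t)u_t(t)-B_3(t)B_3^*(t)u_t(t)=0$, $t>0$, $u(0)=u_0\in V$, $u_t(0)=u_1\in H$, satisfies $E_S(t)=\frac12(\|u(t)\|_V^2+\|u_t(t)\|_H^2)\to0$ as $t\to+\infty$.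
   Context: $H$ is a real Hilbert space, $A:\mathcal D(A)\to H$ a densely defined, self-adjoint, positive, coercive linear operator, $V=\mathcal D(A^{1/2})$ with $\|v\|_V=\|A^{1/2}v\|_H$, $V\hookrightarrow H\equiv H'\hookrightarrow V'$ densely. $U_1,U_3$ are real Hilbert spaces, $B_i(t)\in\mathcal L(U_i,H)$, $i=1,3$, with $B_1^*(t)B_3^*(t)=0$ for $t>0$. There is a sequence $0=t_0<t_1<\cdots$; $I_n=[t_n,t_{n+1})$, $T_n=t_{n+1}-t_n$; $B_3=0$ on $I_{2n}$, $B_1=0$ on $I_{2n+1}$, $B_1\in C^1([t_{2n},t_{2n+1}];\mathcal L(U_1,H))$, $B_3\in C([t_{2n+1},t_{2n+2}];\mathcal L(U_3,H))$. $W_1,W_3$ are Hilbert spaces with $\|u\|_{W_i}^2\le C_i\|u\|_H^2$ for $u\in H$, $i=1,3$. (j): for every $n$ there are $0<m_{2n}\le M_{2n}$ with $m_{2n}\|u\|_{W_1}^2\le\|B_1^*(t)u\|_{U_1}^2\le M_{2n}\|u\|_{W_1}^2$ for $u\in H$, $t\in I_{2n}$. (jj): there is $M_{2n+1}>0$ with $\|B_3^*(t)u\|_{U_3}^2\le M_{2n+1}\|u\|_{W_3}^2$ for $u\in H$, $t\in I_{2n+1}$. *)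

theory Defs
  imports "HOL-Analysis.Analysis"
begin

text \<open>Unbounded (possibly only densely defined) linear operators on a real Hilbert
space are represented by a domain D and a map T, only meaningful on D.\<close>

definition linear_on_dom :: "'h::real_vector set \<Rightarrow> ('h \<Rightarrow> 'h) \<Rightarrow> bool" where
  "linear_on_dom D T \<longleftrightarrow> subspace D \<and>
     (\<forall>x\<in>D. \<forall>y\<in>D. T (x + y) = T x + T y) \<and> (\<forall>x\<in>D. \<forall>a. T (a *\<^sub>R x) = a *\<^sub>R T x)"

definition adjoint_dom :: "'h::real_inner set \<Rightarrow> ('h \<Rightarrow> 'h) \<Rightarrow> 'h set" where
  "adjoint_dom D T = {y. \<exists>z. \<forall>x\<in>D. inner (T x) y = inner x z}"

definition self_adjoint_op :: "'h::real_inner set \<Rightarrow> ('h \<Rightarrow> 'h) \<Rightarrow> bool" where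
  "self_adjoint_op D T \<longleftrightarrow> linear_on_dom D T \<and> closure D = UNIV \<and>
     adjoint_dom D T = D \<and> (\<forall>x\<in>D. \<forall>y\<in>D. inner (T x) y = inner x (T y))"

definition positive_op :: "'h::real_inner set \<Rightarrow> ('h \<Rightarrow> 'h) \<Rightarrow> bool" where
  "positive_op D T \<longleftrightarrow> (\<forall>x\<in>D. inner (T x) x \<ge> 0)"

definition coercive_op :: "'h::real_inner set \<Rightarrow> ('h \<Rightarrow> 'h) \<Rightarrow> bool" where
  "coercive_op D T \<longleftrightarrow> (\<exists>\<alpha>>0. \<forall>x\<in>D. inner (T x) x \<ge> \<alpha> * (norm x)\<^sup>2)"

text \<open>(DV,S) is the positive self-adjoint square root A^(1/2) of (DA,A):
  S self-adjoint, positive, and A = S S as unbounded operators (domains included).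
  This determines A^(1/2) uniquely.\<close>
definition is_op_sqrt :: "'h::real_inner set \<Rightarrow> ('h \<Rightarrow> 'h) \<Rightarrow> 'h set \<Rightarrow> ('h \<Rightarrow> 'h) \<Rightarrow> bool" where
  "is_op_sqrt DA A DV S \<longleftrightarrow> self_adjoint_op DV S \<and> positive_op DV S \<and>
     DA = {x\<in>DV. S x \<in> DV} \<and> (\<forall>x\<in>DA. A x = S (S x))"

text \<open>Weak solution on [0,+oo) of  u'' + A u + G(t) u' = 0,  u(0)=u0, u'(0)=u1,
  with V = DV, norm_V v = norm (S v):
  u in C([0,oo);V), u in C^1([0,oo);H) with derivative u', and for every v in V
  <u'(t),v> - <u1,v> = int_0^t ( - <u(s),v>_V - <G(s) u'(s), v> ) ds.\<close>
definition weak_sol ::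
  "'h::real_inner set \<Rightarrow> ('h \<Rightarrow> 'h) \<Rightarrow> (real \<Rightarrow> 'h \<Rightarrow> 'h) \<Rightarrow> (real \<Rightarrow> 'h) \<Rightarrow> (real \<Rightarrow> 'h)
     \<Rightarrow> 'h \<Rightarrow> 'h \<Rightarrow> bool" where
  "weak_sol DV S G u u' u0 u1 \<longleftrightarrow>
     u 0 = u0 \<and> u' 0 = u1 \<and>
     (\<forall>t\<ge>0. u t \<in> DV) \<and> continuous_on {0..} (\<lambda>t. S (u t)) \<and>
     (\<forall>t\<ge>0. (u has_vector_derivative u' t) (at t within {0..})) \<and> continuous_on {0..} u' \<and>
     (\<forall>v\<in>DV. \<forall>t\<ge>0.
        ((\<lambda>s. - inner (S (u s)) (S v) - inner (G s (u' s)) v) has_integral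
           (inner (u' t) v - inner u1 v)) {0..t})"

definition C1_on_closed :: "real \<Rightarrow> real \<Rightarrow> (real \<Rightarrow> 'a::real_normed_vector) \<Rightarrow> bool" where
  "C1_on_closed a b f \<longleftrightarrow> (\<exists>g g'. (\<forall>s\<in>{a..<b}. g s = f s) \<and>
     (\<forall>s\<in>{a..b}. (g has_vector_derivative g' s) (at s within {a..b})) \<and>
     continuous_on {a..b} g')"

definition C0_on_closed :: "real \<Rightarrow> real \<Rightarrow> (real \<Rightarrow> 'a::real_normed_vector) \<Rightarrow> bool" where
  "C0_on_closed a b f \<longleftrightarrow> (\<exists>g. (\<forall>s\<in>{a..<b}. g s = f s) \<and> continuous_on {a..b} g)"

end

theory Submission
  imports Defs
begin

text \<open>
On a damped interval, let w be the free solution with the data of u at the left end and z = u - w. The energy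
identity for z and the upper bound in (j) give \<open>\<integral> |z'|\<^sup>2 \<le> 4 C\<^sub>1\<^sup>2 M\<^sup>2 T\<^sup>2 \<integral> |u'|\<^sup>2\<close> in the norm of \<open>W\<^sub>1\<close>, so
observability of w bounds the initial energy of u by a multiple of the energy dissipated; hence the energy shrinks by
the factor \<open>c\<^sub>n\<close>. On an anti-damped interval it grows at most by the Gronwall factor, and the series
hypothesis says that the product of all these factors vanishes. Since a weak solution has \<open>u'\<close> only in H, the energy
identity is obtained by applying the regularization \<open>J e = (1 + e\<^sup>2 S\<^sup>2)\<^sup>-\<^sup>1\<close> and letting e tend to 0; existence of w
comes from the bounded skew-adjoint approximations built from the same \<open>J e\<close>.
\<close>

section \<open>The resolvent of the square of a self-adjoint operator\<close>

text \<open>The control operators may jump at the switching times, so the forcing is only continuous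
  inside each interval and bounded up to its ends; the energy identity and all comparisons are set
  up for exactly that situation. The estimates use the variables p = S u and q = u', in which the
  energy is half the squared norm of (p, q) and the free flow is skew.

  The factor c_n comes from two inequalities relating the energies at the ends a, b of a damped
  interval to the integral X of u' in the norm of W_1. Observability yields E(a) \<le> L X with L =
  2c(1 + 4 C_1^2 T^2 M^2), and the lower bound in (j) yields m X \<le> E(a) - E(b). Together they
  bound E(b) by L/(m + L) E(a).\<close>

lemma projection_exists:
  fixes M :: "'a::{real_inner,complete_space} set"
  assumes "closed M" "subspace M"
  shows "\<exists>y\<in>M. \<forall>v\<in>M. inner (x - y) v = 0"
proof -
  define d where "d = Inf ((\<lambda>y. (norm (x - y))\<^sup>2) ` M)"
  have bdd: "bdd_below ((\<lambda>y. (norm (x - y))\<^sup>2) ` M)" by (rule bdd_belowI[of _ 0]) auto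
  have ne: "M \<noteq> {}" using assms(2) subspace_0 by blast
  have lower: "d \<le> (norm (x - y))\<^sup>2" if "y \<in> M" for y
    unfolding d_def using bdd that by (auto intro: cInf_lower)
  have "\<exists>y\<in>M. (norm (x - y))\<^sup>2 < d + 1 / Suc n" for n
    using cInf_lessD[of "(\<lambda>y. (norm (x - y))\<^sup>2) ` M" "d + 1 / Suc n"] ne
    by (auto simp: d_def)
  then obtain y where y: "\<And>n. y n \<in> M" "\<And>n. (norm (x - y n))\<^sup>2 < d + 1 / Suc n" by metis
  \<comment> \<open>The midpoint of two points of \<open>M\<close> lies in \<open>M\<close>, so its
    distance to \<open>x\<close> is no smaller than the infimum; the parallelogram law then forces
    near-minimizers to be close to each other.\<close>
  have para: "(norm (y m - y n))\<^sup>2 \<le> 2 / Suc m + 2 / Suc n" for m n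
  proof -
    have "(1/2) *\<^sub>R (y m + y n) \<in> M" using y assms(2) by (simp add: subspace_add subspace_scale)
    then have "4 * d \<le> 4 * (norm (x - (1/2) *\<^sub>R (y m + y n)))\<^sup>2" using lower by simp
    also have "4 * (norm (x - (1/2) *\<^sub>R (y m + y n)))\<^sup>2 = 2 * (norm (x - y m))\<^sup>2 + 2 * (norm (x - y n))\<^sup>2 - (norm (y m - y n))\<^sup>2"
      unfolding power2_norm_eq_inner by (simp add: inner_simps inner_commute field_simps)
    finally have "4 * d \<le> 2 * (norm (x - y m))\<^sup>2 + 2 * (norm (x - y n))\<^sup>2 - (norm (y m - y n))\<^sup>2" .
    moreover have "2 / real (Suc k) = 2 * (1 / Suc k)" for k by simp
    ultimately show ?thesis using y(2)[of m] y(2)[of n] by linarith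
  qed
  have "Cauchy y"
  proof (rule metric_CauchyI)
    fix e :: real assume "e > 0"
    then obtain N where N: "4 / Suc N < e\<^sup>2"
      using reals_Archimedean[of "e\<^sup>2/4"] by (auto simp: field_simps)
    have "dist (y m) (y n) < e" if "m \<ge> N" "n \<ge> N" for m n
    proof -
      have "2 / real (Suc m) \<le> 2 / Suc N" "2 / real (Suc n) \<le> 2 / Suc N"
        using that by (auto intro!: divide_left_mono)
      then have "(norm (y m - y n))\<^sup>2 < e\<^sup>2" using para[of m n] N by simp
      then show ?thesis using \<open>e > 0\<close> by (simp add: dist_norm power2_less_imp_less)
    qed
    then show "\<exists>N. \<forall>m\<ge>N. \<forall>n\<ge>N. dist (y m) (y n) < e" by blast
  qed
  then obtain l where l: "y \<longlonglongrightarrow> l" using Cauchy_convergent_iff convergent_def by blast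
  have lM: "l \<in> M" using closed_sequentially[OF assms(1)] y(1) l by blast
  have "(\<lambda>n. (norm (x - y n))\<^sup>2) \<longlonglongrightarrow> (norm (x - l))\<^sup>2" by (intro tendsto_intros l)
  moreover have "(\<lambda>n. d + 1 / Suc n) \<longlonglongrightarrow> d + 0"
    by (intro tendsto_intros LIMSEQ_Suc[OF lim_1_over_n])
  ultimately have min: "(norm (x - l))\<^sup>2 \<le> d"
    using y(2) by (intro LIMSEQ_le[where X = "\<lambda>n. (norm (x - y n))\<^sup>2" and Y = "\<lambda>n. d + 1 / Suc n"])
      (auto intro: less_imp_le)
  have "inner (x - l) v = 0" if v: "v \<in> M" for v
  proof -
    have ineq: "2 * t * inner (x - l) v \<le> t\<^sup>2 * (norm v)\<^sup>2" for t
    proof -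
      have "l + t *\<^sub>R v \<in> M" using lM v assms(2) by (simp add: subspace_add subspace_scale)
      then have "(norm (x - l))\<^sup>2 \<le> (norm (x - (l + t *\<^sub>R v)))\<^sup>2" using lower min order_trans by blast
      also have "\<dots> = (norm (x - l))\<^sup>2 - 2 * t * inner (x - l) v + t\<^sup>2 * (norm v)\<^sup>2"
        unfolding power2_norm_eq_inner by (simp add: inner_simps inner_commute algebra_simps power2_eq_square)
      finally show ?thesis by simp
    qed
    show ?thesis
    proof (cases "v = 0")
      case False
      \<comment> \<open>The step t = i / |v|^2 leads to the point nearest \<open>x\<close> along
        \<open>v\<close>; inserted into \<open>ineq\<close> it gives 2 i^2 \<le> i^2 after clearing
        |v|^2.\<close>
      define i where "i = inner (x - l) v"
      have "2 * (i / (norm v)\<^sup>2) * i \<le> (i / (norm v)\<^sup>2)\<^sup>2 * (norm v)\<^sup>2" using ineq unfolding i_def .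
      then have "i\<^sup>2 \<le> 0" using False by (simp add: field_simps power2_eq_square)
      then show ?thesis by (simp add: i_def)
    qed simp
  qed
  then show ?thesis using lM by blast
qed

locale self_adjoint =
  fixes D :: "'h::{real_inner,complete_space} set" and S :: "'h \<Rightarrow> 'h"
  assumes self_adjoint: "self_adjoint_op D S"
begin

lemma subspace_D: "subspace D"
  and S_add: "x \<in> D \<Longrightarrow> y \<in> D \<Longrightarrow> S (x + y) = S x + S y"
  and S_scale: "x \<in> D \<Longrightarrow> S (a *\<^sub>R x) = a *\<^sub>R S x"
  and closure_D: "closure D = UNIV"
  and S_sym: "x \<in> D \<Longrightarrow> y \<in> D \<Longrightarrow> inner (S x) y = inner x (S y)"
  using self_adjoint unfolding self_adjoint_op_def linear_on_dom_def by auto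

lemma S_diff: "x \<in> D \<Longrightarrow> y \<in> D \<Longrightarrow> S (x - y) = S x - S y"
  using S_add[of x "(-1) *\<^sub>R y"] S_scale[of y "-1"] subspace_scale[OF subspace_D, of y "-1"] by simp

lemma inner_D_eqI:
  assumes "\<And>v. v \<in> D \<Longrightarrow> inner v x = inner v y"
  shows "x = y"
proof -
  have "x - y \<in> closure D" by (simp add: closure_D)
  then obtain f where f: "\<And>n::nat. f n \<in> D" "f \<longlonglongrightarrow> x - y" by (auto simp: closure_sequential)
  have "(\<lambda>n. inner (f n) (x - y)) \<longlonglongrightarrow> inner (x - y) (x - y)" by (intro tendsto_intros f)
  moreover have "inner (f n) (x - y) = 0" for n using assms f(1) by (simp add: inner_diff_right)
  ultimately have "inner (x - y) (x - y) = 0" by (simp add: LIMSEQ_const_iff)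
  then show ?thesis by simp
qed

text \<open>Here \<open>adjoint_dom D S = D\<close> enters, beyond mere symmetry. Membership in
  \<open>D\<close> is established this way later, both for resolvents and for the displacement of a
  free solution: a weak identity against all of \<open>D\<close> suffices.\<close>

lemma adjoint_characterization:
  assumes "\<And>v. v \<in> D \<Longrightarrow> inner (S v) x = inner v y"
  shows "x \<in> D" "S x = y"
proof -
  have "x \<in> adjoint_dom D S" unfolding adjoint_dom_def using assms by blast
  then show x: "x \<in> D" using self_adjoint unfolding self_adjoint_op_def by simp
  show "S x = y" using assms S_sym x by (intro inner_D_eqI) (metis)
qed

text \<open>The resolvent equation is solved by projecting (f, 0) onto the graph of \<open>e S\<close>, whose orthogonal
complement is the reflected graph because S is self-adjoint.\<close>

lemma resolvent_exists:
  assumes "e \<noteq> 0"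
  shows "\<exists>x. x \<in> D \<and> S x \<in> D \<and> x + e\<^sup>2 *\<^sub>R S (S x) = f"
proof -
  define G where "G = {z. fst z \<in> D \<and> snd z = e *\<^sub>R S (fst z)}"
  \<comment> \<open>Each condition in the intersection is closed in \<open>z\<close>, so closedness
    of the graph can be read off; self-adjointness makes the conditions sufficient.\<close>
  have G_eq: "G = (\<Inter>v\<in>D. {z. e * inner (S v) (fst z) = inner v (snd z)})"
  proof (intro set_eqI iffI)
    fix z assume "z \<in> G" then show "z \<in> (\<Inter>v\<in>D. {z. e * inner (S v) (fst z) = inner v (snd z)})"
      by (auto simp: G_def S_sym)
  next
    fix z assume "z \<in> (\<Inter>v\<in>D. {z. e * inner (S v) (fst z) = inner v (snd z)})"
    then have "inner (S v) (fst z) = inner v ((1/e) *\<^sub>R snd z)" if "v \<in> D" for v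
      using that assms by (auto simp: field_simps)
    from adjoint_characterization[OF this] show "z \<in> G" using assms by (simp add: G_def)
  qed
  have "closed G" unfolding G_eq by (intro closed_INT ballI closed_Collect_eq continuous_intros)
  moreover have "subspace G" unfolding subspace_def G_def
    using subspace_D S_scale[of 0 0] by (auto simp: subspace_add subspace_scale subspace_0 S_add S_scale algebra_simps)
  ultimately obtain z where z: "z \<in> G" "\<And>w. w \<in> G \<Longrightarrow> inner ((f, 0) - z) w = 0"
    using projection_exists by blast
  obtain x where x: "x \<in> D" "z = (x, e *\<^sub>R S x)" using z(1) by (cases z) (auto simp: G_def)
  \<comment> \<open>Orthogonality of the residual to the graph point (v, e S v) is the weak form of
    e^2 S (S x) = f - x; it also puts \<open>S x\<close> into \<open>D\<close>.\<close>
  have "inner (S v) (S x) = inner v ((1/e\<^sup>2) *\<^sub>R (f - x))" if "v \<in> D" for v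
  proof -
    have "inner ((f, 0) - z) (v, e *\<^sub>R S v) = 0" using z(2) that by (simp add: G_def)
    then have "inner (f - x) v = e\<^sup>2 * inner (S x) (S v)"
      by (simp add: x inner_Pair power2_eq_square)
    then show ?thesis using assms by (simp add: inner_commute)
  qed
  note * = adjoint_characterization[OF this]
  show ?thesis using x *(1) *(2) assms by (intro exI[of _ x]) simp
qed

text \<open>Pairing the equation with \<open>x\<close> and moving one \<open>S\<close> across gives
  |x|^2 + e^2 |S x|^2 = <f, x>; Cauchy-Schwarz does the rest. The bounds make \<open>J e\<close> a
  contraction and \<open>K e\<close> bounded by 1/|e|, and the case f = 0 gives uniqueness.\<close>

lemma resolvent_bounds:
  assumes "x \<in> D" "S x \<in> D" "x + e\<^sup>2 *\<^sub>R S (S x) = f"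
  shows "norm x \<le> norm f" "\<bar>e\<bar> * norm (S x) \<le> norm f"
proof -
  have *: "(norm x)\<^sup>2 + e\<^sup>2 * (norm (S x))\<^sup>2 = inner f x"
    unfolding assms(3)[symmetric] power2_norm_eq_inner by (simp add: inner_add_left S_sym assms(1,2))
  have le: "inner f x \<le> norm f * norm x" by (rule norm_cauchy_schwarz)
  have "norm x * norm x \<le> norm f * norm x" using * le
    by (smt (verit) mult_nonneg_nonneg power2_eq_square zero_le_power2)
  then show 1: "norm x \<le> norm f" by (cases "x = 0") simp_all
  have "(\<bar>e\<bar> * norm (S x))\<^sup>2 \<le> norm f * norm x" using * le by (simp add: power_mult_distrib) (smt (verit) zero_le_power2)
  also have "\<dots> \<le> (norm f)\<^sup>2" using 1 by (simp add: power2_eq_square mult_left_mono)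
  finally show "\<bar>e\<bar> * norm (S x) \<le> norm f" by (rule power2_le_imp_le) simp
qed

lemma resolvent_unique:
  assumes "e \<noteq> 0"
    and "x \<in> D" "S x \<in> D" "x + e\<^sup>2 *\<^sub>R S (S x) = f"
    and "y \<in> D" "S y \<in> D" "y + e\<^sup>2 *\<^sub>R S (S y) = f"
  shows "x = y"
proof -
  have "norm (x - y) \<le> norm (0::'h)"
  proof (rule resolvent_bounds)
    show "x - y \<in> D" "S (x - y) \<in> D" using assms subspace_D by (auto simp: S_diff subspace_diff)
    show "(x - y) + e\<^sup>2 *\<^sub>R S (S (x - y)) = 0"
      using assms(4)[folded assms(7)] by (simp add: S_diff assms scaleR_diff_right flip: add_diff_add)
  qed
  then show ?thesis by simp
qed

section \<open>Resolvent operators and their convergence\<close>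

definition J :: "real \<Rightarrow> 'h \<Rightarrow> 'h" where
  "J e f = (THE x. x \<in> D \<and> S x \<in> D \<and> x + e\<^sup>2 *\<^sub>R S (S x) = f)"

text \<open>The bounded substitute for \<open>S\<close>: symmetric, defined everywhere for e
  \<noteq> 0, and converging to \<open>S\<close> pointwise on \<open>D\<close> as e tends to
  0.\<close>

definition K :: "real \<Rightarrow> 'h \<Rightarrow> 'h" where
  "K e f = S (J e f)"

lemma J_props:
  assumes "e \<noteq> 0"
  shows "J e f \<in> D" "K e f \<in> D" "J e f + e\<^sup>2 *\<^sub>R S (K e f) = f"
proof -
  have "\<exists>!x. x \<in> D \<and> S x \<in> D \<and> x + e\<^sup>2 *\<^sub>R S (S x) = f"
    using resolvent_exists[OF assms] resolvent_unique[OF assms] by blast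
  from theI'[OF this, folded J_def] show "J e f \<in> D" "K e f \<in> D" "J e f + e\<^sup>2 *\<^sub>R S (K e f) = f"
    by (auto simp: K_def)
qed

lemma J_eqI: "e \<noteq> 0 \<Longrightarrow> x \<in> D \<Longrightarrow> S x \<in> D \<Longrightarrow> x + e\<^sup>2 *\<^sub>R S (S x) = f \<Longrightarrow> J e f = x"
  using J_props[of e f] resolvent_unique[of e x f "J e f"] by (simp add: K_def)

lemma norm_J_le: "e \<noteq> 0 \<Longrightarrow> norm (J e f) \<le> norm f"
  and norm_K_le: "e \<noteq> 0 \<Longrightarrow> \<bar>e\<bar> * norm (K e f) \<le> norm f"
  using resolvent_bounds[of "J e f" e f] J_props[of e f] by (auto simp: K_def)

lemma bounded_linear_J:
  assumes "e \<noteq> 0"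
  shows "bounded_linear (J e)"
proof (rule bounded_linear_intro[of _ 1])
  note [simp] = J_props[OF assms, unfolded K_def] subspace_add[OF subspace_D] subspace_scale[OF subspace_D]
  show "J e (f + g) = J e f + J e g" for f g
  proof (rule J_eqI[OF assms])
    have "f + g = (J e f + e\<^sup>2 *\<^sub>R S (K e f)) + (J e g + e\<^sup>2 *\<^sub>R S (K e g))" by (simp add: J_props[OF assms])
    then show "J e f + J e g + e\<^sup>2 *\<^sub>R S (S (J e f + J e g)) = f + g"
      by (simp add: S_add K_def algebra_simps del: J_props(3)[OF assms, unfolded K_def])
  qed (auto simp: S_add)
  show "J e (r *\<^sub>R f) = r *\<^sub>R J e f" for r f
  proof (rule J_eqI[OF assms])
    have "r *\<^sub>R f = r *\<^sub>R (J e f + e\<^sup>2 *\<^sub>R S (K e f))" by (simp add: J_props[OF assms])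
    then show "r *\<^sub>R J e f + e\<^sup>2 *\<^sub>R S (S (r *\<^sub>R J e f)) = r *\<^sub>R f"
      by (simp add: S_scale K_def algebra_simps del: J_props(3)[OF assms, unfolded K_def])
  qed (auto simp: S_scale)
  show "norm (J e f) \<le> norm f * 1" for f using norm_J_le[OF assms] by simp
qed

lemma bounded_linear_K:
  assumes "e \<noteq> 0"
  shows "bounded_linear (K e)"
proof (rule bounded_linear_intro[of _ "1 / \<bar>e\<bar>"])
  interpret J: bounded_linear "J e" by (rule bounded_linear_J[OF assms])
  show "K e (f + g) = K e f + K e g" for f g by (simp add: K_def J.add S_add J_props[OF assms])
  show "K e (r *\<^sub>R f) = r *\<^sub>R K e f" for r f by (simp add: K_def J.scaleR S_scale J_props[OF assms])
  show "norm (K e f) \<le> norm f * (1 / \<bar>e\<bar>)" for f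
    using norm_K_le[OF assms, of f] assms by (simp add: field_simps)
qed

text \<open>Substituting the resolvent equation for the bare argument turns both sides of the first
  identity into <J f, J g> + e^2 <K f, K g>; the second is handled in the same way.\<close>

lemma J_sym: "e \<noteq> 0 \<Longrightarrow> inner (J e f) g = inner f (J e g)"
  and K_sym: "e \<noteq> 0 \<Longrightarrow> inner (K e f) g = inner f (K e g)"
proof -
  assume e: "e \<noteq> 0"
  note p = J_props[OF e]
  have f: "f = J e f + e\<^sup>2 *\<^sub>R S (K e f)" and g: "g = J e g + e\<^sup>2 *\<^sub>R S (K e g)" using p by auto
  have "inner (J e f) (J e g + e\<^sup>2 *\<^sub>R S (K e g)) = inner (J e f + e\<^sup>2 *\<^sub>R S (K e f)) (J e g)"
    using p(1)[of f] p(1)[of g] p(2)[of f] p(2)[of g]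
    by (simp add: inner_simps) (metis K_def S_sym)
  then show "inner (J e f) g = inner f (J e g)" using f g by simp
  have "inner (K e f) (J e g + e\<^sup>2 *\<^sub>R S (K e g)) = inner (J e f + e\<^sup>2 *\<^sub>R S (K e f)) (K e g)"
    using p(1)[of f] p(1)[of g] p(2)[of f] p(2)[of g]
    by (simp add: inner_simps) (metis K_def S_sym)
  then show "inner (K e f) g = inner f (K e g)" using f g by simp
qed

lemma J_S:
  assumes "e \<noteq> 0" "x \<in> D"
  shows "J e (S x) = K e x"
proof (rule J_eqI[OF assms(1) J_props(2)[OF assms(1)]])
  note p = J_props[OF assms(1), of x]
  \<comment> \<open>Solved for \<open>S (K e x)\<close>, the resolvent equation shows a multiple of
    x - J e x, a difference of elements of \<open>D\<close>. So \<open>K e x\<close> is regular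
    enough to solve the equation with right-hand side \<open>S x\<close>.\<close>
  have eq: "S (K e x) = (1 / e\<^sup>2) *\<^sub>R (x - J e x)" using p(3) assms(1)
    by (metis add_diff_cancel_left' inverse_eq_divide power_not_zero vector_fraction_eq_iff scaleR_scaleR left_inverse scaleR_one)
  show "S (K e x) \<in> D" unfolding eq using p assms subspace_D by (simp add: subspace_diff subspace_scale)
  show "K e x + e\<^sup>2 *\<^sub>R S (S (K e x)) = S x"
    unfolding eq using assms p subspace_D by (simp add: S_scale S_diff subspace_diff K_def)
qed

lemma J_K: "e \<noteq> 0 \<Longrightarrow> J e (K d f) = S (J e (J d f))" if "d \<noteq> 0"
  using J_S[of e "J d f"] J_props(1)[OF that] by (simp add: K_def)

lemma J_commute:
  assumes "e \<noteq> 0" "d \<noteq> 0"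
  shows "J e (J d f) = J d (J e f)"
proof (rule J_eqI[OF assms(2), symmetric])
  interpret J: bounded_linear "J e" by (rule bounded_linear_J[OF assms(1)])
  show "J e (J d f) \<in> D" by (rule J_props[OF assms(1)])
  show "S (J e (J d f)) \<in> D" using J_props[OF assms(1)] by (simp add: K_def)
  have "S (S (J e (J d f))) = J e (S (K d f))"
    using J_S[OF assms(1), of "K d f"] J_props[OF assms(2)] J_K[OF assms(2,1)] by (simp add: K_def)
  then have "J e (J d f) + d\<^sup>2 *\<^sub>R S (S (J e (J d f))) = J e (J d f + d\<^sup>2 *\<^sub>R S (K d f))"
    by (simp add: J.add J.scaleR)
  then show "J e (J d f) + d\<^sup>2 *\<^sub>R S (S (J e (J d f))) = J e f" by (simp add: J_props[OF assms(2)])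
qed

lemma K_commute:
  assumes "e \<noteq> 0" "d \<noteq> 0"
  shows "K e (K d f) = K d (K e f)"
  using J_commute[OF assms, of f] J_K[OF assms(2,1)] J_K[OF assms] by (simp add: K_def)

lemma J_K_commute: "e \<noteq> 0 \<Longrightarrow> J e (K e f) = K e (J e f)"
  using J_K[of e e f] by (simp add: K_def)

text \<open>On \<open>D\<close> there is a rate: J y - y = - e^2 S (K y) = - e^2 K (S y), of norm at
  most |e| |S y|. Since the \<open>J e\<close> are contractions, density of \<open>D\<close> extends
  the convergence to the whole space.\<close>

lemma tendsto_J:
  assumes "e \<longlonglongrightarrow> 0" "\<And>n::nat. e n \<noteq> 0"
  shows "(\<lambda>n. J (e n) x) \<longlonglongrightarrow> x"
proof (rule metric_LIMSEQ_I)
  fix r :: real assume "r > 0"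
  have "x \<in> closure D" by (simp add: closure_D)
  then obtain y where y: "y \<in> D" "dist y x < r / 3" using \<open>r > 0\<close> closure_approachable
    by (metis divide_pos_pos zero_less_numeral)
  have est: "norm (J (e n) y - y) \<le> \<bar>e n\<bar> * norm (S y)" for n
  proof -
    have "norm (J (e n) y - y) = norm ((e n)\<^sup>2 *\<^sub>R S (K (e n) y))"
      using J_props(3)[OF assms(2), of n y] by (metis add_diff_cancel_left' norm_minus_commute)
    also have "S (K (e n) y) = K (e n) (S y)"
      using J_S[OF assms(2) y(1), of n] by (simp add: K_def)
    also have "norm ((e n)\<^sup>2 *\<^sub>R K (e n) (S y)) = \<bar>e n\<bar> * (\<bar>e n\<bar> * norm (K (e n) (S y)))"
      by (simp add: power2_eq_square abs_mult)
    also have "\<dots> \<le> \<bar>e n\<bar> * norm (S y)" by (intro mult_left_mono norm_K_le assms) auto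
    finally show ?thesis .
  qed
  have "(\<lambda>n. \<bar>e n\<bar> * norm (S y)) \<longlonglongrightarrow> \<bar>0\<bar> * norm (S y)" by (intro tendsto_intros assms)
  then have "eventually (\<lambda>n. \<bar>e n\<bar> * norm (S y) < r / 3) sequentially"
    using \<open>r > 0\<close> by (intro order_tendstoD(2)) auto
  then obtain N where N: "\<And>n. n \<ge> N \<Longrightarrow> \<bar>e n\<bar> * norm (S y) < r / 3" by (auto simp: eventually_sequentially)
  have "dist (J (e n) x) x < r" if "n \<ge> N" for n
  proof -
    interpret J: bounded_linear "J (e n)" by (rule bounded_linear_J[OF assms(2)])
    have "norm (J (e n) x - x) \<le> norm (J (e n) (x - y)) + norm (J (e n) y - y) + norm (y - x)"
    proof -
      have "J (e n) x - x = J (e n) (x - y) + (J (e n) y - y) + (y - x)" by (simp add: J.diff)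
      then show ?thesis by (metis add_mono norm_triangle_ineq norm_triangle_mono order_refl)
    qed
    also have "\<dots> \<le> norm (x - y) + r / 3 + norm (y - x)"
      using norm_J_le[OF assms(2), of n "x - y"] est[of n] N[OF that] by linarith
    finally show ?thesis using y(2) by (simp add: dist_norm norm_minus_commute)
  qed
  then show "\<exists>N. \<forall>n\<ge>N. dist (J (e n) x) x < r" by blast
qed

lemma tendsto_K:
  assumes "e \<longlonglongrightarrow> 0" "\<And>n::nat. e n \<noteq> 0" "x \<in> D"
  shows "(\<lambda>n. K (e n) x) \<longlonglongrightarrow> S x"
  using tendsto_J[OF assms(1,2), of "S x"] J_S[OF assms(2,3)] by simp

end

section \<open>The energy identity for weak solutions\<close>

lemma weak_increment_bound:
  fixes Q h :: "real \<Rightarrow> 'a::real_inner"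
  assumes weak: "\<And>v. ((\<lambda>r. inner (h r) v) has_integral inner (Q t - Q s) v) {s..t}"
    and "s \<le> t" and h: "\<And>r. r \<in> {s..t} \<Longrightarrow> norm (h r - c) \<le> e"
  shows "norm (Q t - Q s - (t - s) *\<^sub>R c) \<le> e * (t - s)"
proof -
  have e: "0 \<le> e" using order_trans[OF norm_ge_zero h[of s]] \<open>s \<le> t\<close> by simp
  define v where "v = Q t - Q s - (t - s) *\<^sub>R c"
  have "((\<lambda>r. inner (h r) v - inner c v) has_integral inner (Q t - Q s) v - (t - s) * inner c v) {s..t}"
    using has_integral_diff[OF weak has_integral_const_real[of "inner c v" s t]] \<open>s \<le> t\<close> by simp
  then have int: "((\<lambda>r. inner (h r - c) v) has_integral inner v v) {s..t}"
    by (simp add: v_def[symmetric] inner_diff_left[symmetric])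
      (simp add: v_def inner_diff_left)
  have "norm (inner v v) \<le> (e * norm v) * measure lborel {s..t}"
  proof (rule has_integral_bound_real[OF _ finite.emptyI int])
    show "0 \<le> e * norm v" using e by simp
    fix r assume "r \<in> {s..t} - {}"
    then show "norm (inner (h r - c) v) \<le> e * norm v"
      using Cauchy_Schwarz_ineq2[of "h r - c" v] h[of r] mult_right_mono[of _ e "norm v"]
      by (simp) (meson norm_ge_zero order_trans)
  qed
  then have "norm v * norm v \<le> (e * (t - s)) * norm v"
    using \<open>s \<le> t\<close> by (simp add: norm_eq_sqrt_inner mult_ac)
  then show ?thesis using e \<open>s \<le> t\<close> by (cases "v = 0") (auto simp: v_def[symmetric])
qed

text \<open>Testing the increment against itself avoids vector-valued integrals, which would need class
\<open>banach\<close>.\<close>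

lemma has_vector_derivative_of_weak_integral:
  fixes Q h :: "real \<Rightarrow> 'a::real_inner"
  assumes weak: "\<And>v s t. a \<le> s \<Longrightarrow> s \<le> t \<Longrightarrow> t \<le> b \<Longrightarrow>
      ((\<lambda>r. inner (h r) v) has_integral inner (Q t - Q s) v) {s..t}"
    and cont: "continuous_on {a<..<b} h" and x: "x \<in> {a<..<b}"
  shows "(Q has_vector_derivative h x) (at x)"
  unfolding has_vector_derivative_def has_derivative_at_alt
proof (intro conjI allI impI)
  show "bounded_linear (\<lambda>r. r *\<^sub>R h x)" by (rule bounded_linear_scaleR_left)
  fix e :: real assume "e > 0"
  have "isCont h x" using cont x by (simp add: continuous_on_eq_continuous_at)
  then obtain d where d: "d > 0" "\<And>r. dist r x < d \<Longrightarrow> dist (h r) (h x) < e"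
    using \<open>e > 0\<close> by (auto simp: continuous_at_eps_delta)
  define d' where "d' = min d (min (x - a) (b - x))"
  have "d' > 0" using d x by (auto simp: d'_def)
  moreover have "norm (Q y - Q x - (y - x) *\<^sub>R h x) \<le> e * norm (y - x)" if y: "norm (y - x) < d'" for y
  proof -
    have ab: "a < y" "y < b" "\<bar>y - x\<bar> < d" using y by (auto simp: d'_def)
    show ?thesis
    proof (cases "x \<le> y")
      case True
      have "norm (Q y - Q x - (y - x) *\<^sub>R h x) \<le> e * (y - x)"
      proof (rule weak_increment_bound[OF weak True])
        fix r assume "r \<in> {x..y}"
        then show "norm (h r - h x) \<le> e" using d(2)[of r] ab by (auto simp: dist_norm)
      qed (use True x ab in auto)
      then show ?thesis using True by simp
    next
      case False
      have "norm (Q x - Q y - (x - y) *\<^sub>R h x) \<le> e * (x - y)"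
      proof (rule weak_increment_bound[OF weak])
        fix r assume "r \<in> {y..x}"
        then show "norm (h r - h x) \<le> e" using d(2)[of r] ab by (auto simp: dist_norm)
      qed (use False x ab in auto)
      moreover have "Q x - Q y - (x - y) *\<^sub>R h x = - (Q y - Q x - (y - x) *\<^sub>R h x)" by (simp add: algebra_simps)
      ultimately show ?thesis using False by (metis abs_of_neg diff_less_0_iff_less minus_diff_eq norm_minus_cancel not_le real_norm_def)
    qed
  qed
  ultimately show "\<exists>d>0. \<forall>y. norm (y - x) < d \<longrightarrow> norm (Q y - Q x - (y - x) *\<^sub>R h x) \<le> e * norm (y - x)" by blast
qed

context self_adjoint
begin

text \<open>The weak form of the first-order system \<open>p' = S q\<close>, \<open>q' = f - S p\<close>, which
\<open>z'' + S\<^sup>2 z = f\<close> becomes for \<open>p = S z\<close>, \<open>q = z'\<close>.\<close>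

definition wave_flow :: "real \<Rightarrow> real \<Rightarrow> (real \<Rightarrow> 'h) \<Rightarrow> (real \<Rightarrow> 'h) \<Rightarrow> (real \<Rightarrow> 'h) \<Rightarrow> bool" where
  "wave_flow a b p q f \<longleftrightarrow> continuous_on {a..b} p \<and> continuous_on {a..b} q \<and>
     (\<forall>v\<in>D. \<forall>s t. a \<le> s \<longrightarrow> s \<le> t \<longrightarrow> t \<le> b \<longrightarrow>
        ((\<lambda>r. inner (q r) (S v)) has_integral inner (p t - p s) v) {s..t} \<and>
        ((\<lambda>r. inner (f r) v - inner (p r) (S v)) has_integral inner (q t - q s) v) {s..t})"

lemma wave_flow_subinterval:
  assumes "wave_flow a b p q f" "a \<le> a'" "b' \<le> b"
  shows "wave_flow a' b' p q f"
proof -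
  have "{a'..b'} \<subseteq> {a..b}" using assms(2,3) by auto
  moreover have "a \<le> s" "t \<le> b" if "a' \<le> s" "t \<le> b'" for s t using that assms(2,3) by auto
  ultimately show ?thesis using assms(1) continuous_on_subset unfolding wave_flow_def by meson
qed

lemma wave_flow_diff:
  assumes "wave_flow a b p q f" "wave_flow a b p' q' f'"
  shows "wave_flow a b (\<lambda>t. p t - p' t) (\<lambda>t. q t - q' t) (\<lambda>t. f t - f' t)"
  unfolding wave_flow_def
proof (intro conjI ballI allI impI)
  fix v s t assume "v \<in> D" and st: "a \<le> s" "s \<le> t" "t \<le> b"
  then have
    "((\<lambda>r. inner (q r) (S v) - inner (q' r) (S v)) has_integral inner (p t - p s) v - inner (p' t - p' s) v) {s..t}"
    "((\<lambda>r. (inner (f r) v - inner (p r) (S v)) - (inner (f' r) v - inner (p' r) (S v))) has_integral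
        inner (q t - q s) v - inner (q' t - q' s) v) {s..t}"
    using assms unfolding wave_flow_def by (auto intro!: has_integral_diff)
  then show
    "((\<lambda>r. inner (q r - q' r) (S v)) has_integral inner (p t - p' t - (p s - p' s)) v) {s..t}"
    "((\<lambda>r. inner (f r - f' r) v - inner (p r - p' r) (S v)) has_integral inner (q t - q' t - (q s - q' s)) v) {s..t}"
    by (simp_all add: inner_diff_left algebra_simps)
qed (use assms in \<open>auto simp: wave_flow_def intro: continuous_on_diff\<close>)

text \<open>Test vectors \<open>J e v\<close> lie in \<open>D\<close> and satisfy S (J e v) = K e v,
  so symmetry turns the weak system into the strong one (J p)' = K q, (J q)' = J f - K p, whose
  right-hand sides are continuous inside the interval.\<close>

lemma regularized_energy_identity:
  assumes flow: "wave_flow a b p q f" and e: "e \<noteq> 0" and ab: "a \<le> b" and f: "continuous_on {a<..<b} f"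
  defines "E \<equiv> \<lambda>t. ((norm (J e (p t)))\<^sup>2 + (norm (J e (q t)))\<^sup>2) / 2"
  shows "((\<lambda>r. inner (J e (f r)) (J e (q r))) has_integral (E b - E a)) {a..b}"
proof (rule fundamental_theorem_of_calculus_interior[OF ab])
  interpret J: bounded_linear "J e" by (rule bounded_linear_J[OF e])
  interpret K: bounded_linear "K e" by (rule bounded_linear_K[OF e])
  have cont: "continuous_on {a..b} p" "continuous_on {a..b} q" using flow by (auto simp: wave_flow_def)
  then have cont': "continuous_on {a<..<b} p" "continuous_on {a<..<b} q"
    by (meson continuous_on_subset greaterThanLessThan_subseteq_atLeastAtMost_iff order_refl)+
  show "continuous_on {a..b} E" unfolding E_def
    by (intro continuous_intros J.continuous_on cont) simp
  fix x assume x: "x \<in> {a<..<b}"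
  have dp: "((\<lambda>t. J e (p t)) has_vector_derivative K e (q x)) (at x)"
  proof (rule has_vector_derivative_of_weak_integral[OF _ _ x])
    fix v s t assume "a \<le> s" "s \<le> t" "t \<le> b"
    then have "((\<lambda>r. inner (q r) (K e v)) has_integral inner (p t - p s) (J e v)) {s..t}"
      using flow J_props(1)[OF e, of v] unfolding wave_flow_def K_def by blast
    then show "((\<lambda>r. inner (K e (q r)) v) has_integral inner (J e (p t) - J e (p s)) v) {s..t}"
      by (simp add: K_sym[OF e] J_sym[OF e] flip: J.diff)
  qed (intro K.continuous_on cont')
  have dq: "((\<lambda>t. J e (q t)) has_vector_derivative J e (f x) - K e (p x)) (at x)"
  proof (rule has_vector_derivative_of_weak_integral[OF _ _ x])
    fix v s t assume "a \<le> s" "s \<le> t" "t \<le> b"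
    then have "((\<lambda>r. inner (f r) (J e v) - inner (p r) (K e v)) has_integral inner (q t - q s) (J e v)) {s..t}"
      using flow J_props(1)[OF e, of v] unfolding wave_flow_def K_def by blast
    then show "((\<lambda>r. inner (J e (f r) - K e (p r)) v) has_integral inner (J e (q t) - J e (q s)) v) {s..t}"
      by (simp add: K_sym[OF e] J_sym[OF e] inner_diff_left[of "J e _" "K e _"] flip: J.diff)
  qed (intro continuous_intros J.continuous_on K.continuous_on cont' f)
  \<comment> \<open>The coupling terms cancel because \<open>J e\<close> and \<open>K e\<close> are
    symmetric and commute; only the work of the forcing remains.\<close>
  have "inner (J e (p x)) (K e (q x)) = inner (J e (q x)) (K e (p x))"
    by (metis J_K_commute J_sym K_sym e inner_commute)
  then have eq: "(2 * inner (J e (p x)) (K e (q x)) + 2 * inner (J e (q x)) (J e (f x) - K e (p x))) / 2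
      = inner (J e (f x)) (J e (q x))"
    by (simp add: inner_diff_right inner_commute)
  have "(E has_derivative (\<lambda>r. r * ((2 * inner (J e (p x)) (K e (q x)) + 2 * inner (J e (q x)) (J e (f x) - K e (p x))) / 2))) (at x)"
    unfolding E_def power2_norm_eq_inner
    by (rule derivative_eq_intros dp[unfolded has_vector_derivative_def] dq[unfolded has_vector_derivative_def] refl)+
      (auto simp: algebra_simps inner_commute add_divide_distrib diff_divide_distrib)
  then show "(E has_vector_derivative inner (J e (f x)) (J e (q x))) (at x)"
    unfolding has_vector_derivative_def eq by simp
qed

text \<open>Contractivity of \<open>J e\<close> bounds the regularized integrands by sup |f| sup |q|
  uniformly in e, so dominated convergence applies. This is where boundedness of \<open>f\<close> up
  to the endpoints is used.\<close>

lemma energy_identity: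
  assumes flow: "wave_flow a b p q f" and ab: "a \<le> b" and f: "continuous_on {a<..<b} f"
    and bdd: "bounded (f ` {a..b})"
  defines "E \<equiv> \<lambda>t. ((norm (p t))\<^sup>2 + (norm (q t))\<^sup>2) / 2"
  shows "((\<lambda>r. inner (f r) (q r)) has_integral (E b - E a)) {a..b}"
proof -
  define e where "e n = 1 / real (Suc n)" for n
  have e: "e \<longlonglongrightarrow> 0" "\<And>n. e n \<noteq> 0" unfolding e_def by (rule LIMSEQ_Suc[OF lim_1_over_n]) simp
  define E' where "E' n t = ((norm (J (e n) (p t)))\<^sup>2 + (norm (J (e n) (q t)))\<^sup>2) / 2" for n t
  have reg: "((\<lambda>r. inner (J (e n) (f r)) (J (e n) (q r))) has_integral (E' n b - E' n a)) {a..b}" for n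
    unfolding E'_def by (rule regularized_energy_identity[OF flow e(2) ab f])
  have "compact (q ` {a..b})" using flow by (intro compact_continuous_image) (auto simp: wave_flow_def)
  then obtain Bq where Bq: "\<And>r. r \<in> {a..b} \<Longrightarrow> norm (q r) \<le> Bq" using compact_imp_bounded bounded_iff
    by (metis imageI)
  obtain Bf where Bf: "\<And>r. r \<in> {a..b} \<Longrightarrow> norm (f r) \<le> Bf" using bdd bounded_iff by (metis imageI)
  have bound: "norm (inner (J (e n) (f r)) (J (e n) (q r))) \<le> Bf * Bq" if "r \<in> {a..b}" for n r
  proof -
    have "norm (inner (J (e n) (f r)) (J (e n) (q r))) \<le> norm (J (e n) (f r)) * norm (J (e n) (q r))"
      by (simp add: Cauchy_Schwarz_ineq2)
    also have "\<dots> \<le> Bf * Bq"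
      using norm_J_le[OF e(2), of n "f r"] norm_J_le[OF e(2), of n "q r"] Bf[OF that] Bq[OF that]
        order_trans[OF norm_ge_zero Bf[OF that]]
      by (intro mult_mono) (auto intro: order_trans)
    finally show ?thesis .
  qed
  have lim: "(\<lambda>n. inner (J (e n) (f r)) (J (e n) (q r))) \<longlonglongrightarrow> inner (f r) (q r)" for r
    by (intro tendsto_intros tendsto_J e)
  have *: "(\<lambda>r. inner (f r) (q r)) integrable_on {a..b}"
    "(\<lambda>n. integral {a..b} (\<lambda>r. inner (J (e n) (f r)) (J (e n) (q r)))) \<longlonglongrightarrow> integral {a..b} (\<lambda>r. inner (f r) (q r))"
    by (rule dominated_convergence[OF has_integral_integrable[OF reg] integrable_const_ivl bound lim]; assumption)+
  have "(\<lambda>n. E' n b - E' n a) \<longlonglongrightarrow> E b - E a"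
    unfolding E'_def E_def by (intro tendsto_intros tendsto_J e) simp_all
  then have "integral {a..b} (\<lambda>r. inner (f r) (q r)) = E b - E a"
    using *(2) LIMSEQ_unique integral_unique[OF reg] by simp
  then show ?thesis using *(1) has_integral_integral by metis
qed

end

section \<open>Existence of free solutions by Yosida approximation\<close>

text \<open>The solution is the exponential series with terms t^k / k! L^k x0. It converges
  uniformly on bounded time intervals, and differentiating a partial sum gives \<open>L\<close> of
  the preceding one, so the derivatives converge uniformly as well.\<close>

lemma bounded_linear_ode_exists:
  fixes L :: "'a::banach \<Rightarrow> 'a"
  assumes "bounded_linear L"
  shows "\<exists>x. x 0 = x0 \<and> (\<forall>t. (x has_vector_derivative L (x t)) (at t))"
proof -
  interpret L: bounded_linear L by fact
  obtain B where B: "B \<ge> 0" "\<And>x. norm (L x) \<le> norm x * B" using L.nonneg_bounded by blast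
  define f where "f k t = (t ^ k / fact k) *\<^sub>R (L ^^ k) x0" for k and t :: real
  define P where "P n t = (\<Sum>k<n. f k t)" for n t
  define X where "X t = suminf (\<lambda>k. f k t)" for t
  have iter: "norm ((L ^^ k) x0) \<le> B ^ k * norm x0" for k
  proof (induction k)
    case (Suc k)
    have "norm ((L ^^ Suc k) x0) \<le> norm ((L ^^ k) x0) * B" using B(2) by simp
    also have "\<dots> \<le> (B ^ k * norm x0) * B" using Suc B(1) by (rule mult_right_mono)
    finally show ?case by (simp add: mult_ac)
  qed simp
  have df: "(f (Suc k) has_vector_derivative L (f k t)) (at t)" for k t
  proof -
    have "((\<lambda>t::real. t ^ Suc k / fact (Suc k)) has_real_derivative t ^ k / fact k) (at t)"
      using DERIV_cdivide[OF DERIV_pow[of "Suc k" t UNIV], of "fact (Suc k)"]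
      by (simp del: of_nat_Suc power_Suc)
    from has_vector_derivative_scaleR[OF this has_vector_derivative_const]
    show ?thesis by (simp add: f_def[abs_def] L.scaleR)
  qed
  have dP: "(P (Suc n) has_vector_derivative L (P n t)) (at t)" for n t
  proof -
    have "((\<lambda>t. f 0 t + (\<Sum>k<n. f (Suc k) t)) has_vector_derivative 0 + (\<Sum>k<n. L (f k t))) (at t)"
      by (intro has_vector_derivative_add has_vector_derivative_sum df)
        (simp add: f_def has_vector_derivative_const)
    moreover have "P (Suc n) = (\<lambda>t. f 0 t + (\<Sum>k<n. f (Suc k) t))"
      unfolding P_def by (rule ext) (rule sum.lessThan_Suc_shift)
    ultimately show ?thesis by (simp add: P_def L.sum)
  qed
  have unif: "uniform_limit {-T..T} P X sequentially" for T
    unfolding P_def X_def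
  proof (rule Weierstrass_m_test)
    fix n t assume "t \<in> {-T..T}"
    then have t: "\<bar>t\<bar> \<le> T" by auto
    have "norm (f n t) = \<bar>t\<bar> ^ n / fact n * norm ((L ^^ n) x0)" by (simp add: f_def power_abs)
    also have "\<dots> \<le> T ^ n / fact n * (B ^ n * norm x0)"
      using t iter by (intro mult_mono divide_right_mono power_mono) auto
    finally show "norm (f n t) \<le> (inverse (fact n) * (T * B) ^ n) * norm x0"
      by (simp add: power_mult_distrib field_simps)
  qed (intro summable_mult2 summable_exp)
  have dX: "(X has_vector_derivative L (X t)) (at t)" for t
  proof -
    define T where "T = \<bar>t\<bar> + 1"
    have tT: "t \<in> {-T<..<T}" by (auto simp: T_def)
    have conv: "(\<lambda>n. P (Suc n) r) \<longlonglongrightarrow> X r" if "r \<in> {-T<..<T}" for r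
      using LIMSEQ_Suc[OF tendsto_uniform_limitI[OF unif[of T], of r]] that by auto
    have "\<exists>g. \<forall>r\<in>{-T<..<T}. (\<lambda>n. P (Suc n) r) \<longlonglongrightarrow> g r \<and>
        (g has_derivative (\<lambda>h. h *\<^sub>R L (X r))) (at r within {-T<..<T})"
    \<comment> \<open>The sequence is indexed by \<open>Suc n\<close> so that its derivative is
      \<open>L (P n r)\<close>.\<close>
    proof (rule has_derivative_sequence[where f' = "\<lambda>n r h. h *\<^sub>R L (P n r)"])
      show "(P (Suc n) has_derivative (\<lambda>h. h *\<^sub>R L (P n r))) (at r within {-T<..<T})" for n r
        using dP[of n r] unfolding has_vector_derivative_def by (rule has_derivative_at_withinI)
      fix e :: real assume "e > 0"
      \<comment> \<open>Dividing by \<open>B + 1\<close> instead of \<open>B\<close> covers the case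
        \<open>B = 0\<close>.\<close>
      then have "e / (B + 1) > 0" using B(1) by simp
      from uniform_limitD[OF unif[of T] this]
      show "\<forall>\<^sub>F n in sequentially. \<forall>r\<in>{-T<..<T}. \<forall>h. norm (h *\<^sub>R L (P n r) - h *\<^sub>R L (X r)) \<le> e * norm h"
      proof (eventually_elim, intro ballI allI)
        fix n and r h :: real assume "\<forall>r\<in>{-T..T}. dist (P n r) (X r) < e / (B + 1)" and r: "r \<in> {-T<..<T}"
        then have d: "norm (P n r - X r) \<le> e / (B + 1)" by (auto simp: dist_norm less_imp_le)
        have "norm (L (P n r - X r)) \<le> norm (P n r - X r) * B" by (rule B)
        also have "\<dots> \<le> e / (B + 1) * B" using d B(1) by (rule mult_right_mono)
        also have "\<dots> \<le> e" using B(1) \<open>e > 0\<close> by (simp add: field_simps)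
        finally have "norm h * norm (L (P n r - X r)) \<le> norm h * e" by (rule mult_left_mono) simp
        then show "norm (h *\<^sub>R L (P n r) - h *\<^sub>R L (X r)) \<le> e * norm h"
          by (simp add: L.diff mult.commute flip: scaleR_diff_right)
      qed
    qed (use tT conv in auto)
    then obtain g where g: "\<And>r. r \<in> {-T<..<T} \<Longrightarrow> (\<lambda>n. P (Suc n) r) \<longlonglongrightarrow> g r"
      "\<And>r. r \<in> {-T<..<T} \<Longrightarrow> (g has_derivative (\<lambda>h. h *\<^sub>R L (X r))) (at r within {-T<..<T})" by blast
    have "g r = X r" if "r \<in> {-T<..<T}" for r using LIMSEQ_unique g(1) conv that by blast
    then have "(X has_derivative (\<lambda>h. h *\<^sub>R L (X t))) (at t within {-T<..<T})"
      using has_derivative_transform[OF tT _ g(2)[OF tT]] by metis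
    then show ?thesis using at_within_open[OF tT] by (simp add: has_vector_derivative_def)
  qed
  have "X 0 = x0"
  proof -
    have "(\<lambda>k. f k 0) sums (\<Sum>k\<in>{0}. f k 0)" by (rule sums_finite) (simp_all add: f_def)
    then show ?thesis by (simp add: X_def sums_iff f_def)
  qed
  then show ?thesis using dX by blast
qed

section \<open>Norms along skew flows\<close>

lemma has_real_derivative_norm_square:
  fixes y :: "real \<Rightarrow> 'a::real_inner"
  assumes "(y has_vector_derivative y') (at t)"
  shows "((\<lambda>t. (norm (y t))\<^sup>2) has_real_derivative 2 * inner y' (y t)) (at t)"
  unfolding power2_norm_eq_inner has_field_derivative_def
  by (rule derivative_eq_intros assms[unfolded has_vector_derivative_def] refl)+
    (auto simp: algebra_simps inner_commute)

lemma norm_const_of_skew: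
  fixes y :: "real \<Rightarrow> 'a::real_inner"
  assumes "\<And>t. (y has_vector_derivative y' t) (at t)" "\<And>t. inner (y' t) (y t) = 0"
  shows "norm (y t) = norm (y 0)"
proof -
  have "\<forall>t. ((\<lambda>t. (norm (y t))\<^sup>2) has_real_derivative 0) (at t)"
    using has_real_derivative_norm_square[OF assms(1)] assms(2) by simp
  from DERIV_isconst_all[OF this, of t 0] show ?thesis by simp
qed

text \<open>A Gronwall argument: 2 k |y| \<le> k^2 + |y|^2 makes (|y|^2 + k^2) exp(-t)
  nonincreasing. Working with the square avoids differentiating the norm where y vanishes.\<close>

lemma norm_bound_of_forced_skew:
  fixes y :: "real \<Rightarrow> 'a::real_inner"
  assumes "\<And>t. (y has_vector_derivative y' t) (at t)" "\<And>t. inner (y' t) (y t) \<le> k * norm (y t)"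
    and "y 0 = 0" "t \<ge> 0"
  shows "(norm (y t))\<^sup>2 \<le> k\<^sup>2 * exp t"
proof -
  define \<phi> where "\<phi> t = ((norm (y t))\<^sup>2 + k\<^sup>2) * exp (- t)" for t
  have "\<phi> t \<le> \<phi> 0"
  proof (rule DERIV_nonpos_imp_nonincreasing[OF \<open>t \<ge> 0\<close>])
    fix s :: real
    have "(\<phi> has_real_derivative (2 * inner (y' s) (y s) - ((norm (y s))\<^sup>2 + k\<^sup>2)) * exp (- s)) (at s)"
      unfolding \<phi>_def
      by (rule derivative_eq_intros has_real_derivative_norm_square assms(1) refl)+ (simp add: algebra_simps)
    moreover have "2 * inner (y' s) (y s) - ((norm (y s))\<^sup>2 + k\<^sup>2) \<le> 0"
      using assms(2)[of s] sum_squares_bound[of k "norm (y s)"] by simp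
    ultimately show "\<exists>z. (\<phi> has_real_derivative z) (at s) \<and> z \<le> 0"
      by (intro exI conjI) (auto intro: mult_nonpos_nonneg)
  qed
  then have "((norm (y t))\<^sup>2 + k\<^sup>2) * exp (- t) * exp t \<le> k\<^sup>2 * exp t"
    using assms(3) by (intro mult_right_mono) (auto simp: \<phi>_def)
  moreover have "((norm (y t))\<^sup>2 + k\<^sup>2) * exp (- t) * exp t = (norm (y t))\<^sup>2 + k\<^sup>2"
    by (simp add: exp_minus_inverse mult.assoc mult.commute[of "exp (- t)"])
  ultimately have "(norm (y t))\<^sup>2 + k\<^sup>2 \<le> k\<^sup>2 * exp t" by simp
  then show ?thesis using zero_le_power2[of k] by linarith
qed

lemma at_within_atLeast_eq_Icc:
  fixes t :: real
  assumes "a \<le> t" "t < b"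
  shows "at t within {a..} = at t within {a..b}"
  by (rule at_within_nhd[of _ "{..<b}"]) (use assms in auto)

locale self_adjoint_banach = self_adjoint D S
  for D :: "'h::{real_inner,banach} set" and S :: "'h \<Rightarrow> 'h"
begin

text \<open>The bounded skew operator Y_n that replaces the generator (p, q) -> (S q, - S p) of the
  free flow, with parameter e = 1/(n+1), which never vanishes.\<close>

definition yosida :: "nat \<Rightarrow> 'h \<times> 'h \<Rightarrow> 'h \<times> 'h" where
  "yosida n z = (K (1 / Suc n) (snd z), - K (1 / Suc n) (fst z))"

lemma bounded_linear_yosida: "bounded_linear (yosida n)"
  unfolding yosida_def
  by (intro bounded_linear_Pair bounded_linear_minus bounded_linear_compose[OF bounded_linear_K]
      bounded_linear_fst bounded_linear_snd) auto

lemma yosida_skew: "inner (yosida n z) z = 0"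
  using K_sym[of "1 / Suc n" "snd z" "fst z"]
  by (cases z) (simp add: yosida_def inner_Pair inner_commute)

text \<open>Commutation keeps |Y_m z - Y_n z| constant along the flow of Y_n; the comparison of
  approximate flows rests on it.\<close>

lemma yosida_commute: "yosida m (yosida n z) = yosida n (yosida m z)"
proof -
  have "K e (- x) = - K e x" if "e \<noteq> 0" for e x
    using bounded_linear_K[OF that] by (simp add: bounded_linear.linear linear_neg)
  then show ?thesis
    using K_commute[of "1 / Suc m" "1 / Suc n"] by (simp add: yosida_def)
qed

lemma Cauchy_yosida:
  assumes "z \<in> D \<times> D"
  shows "Cauchy (\<lambda>n. yosida n z)"
proof -
  have e: "(\<lambda>n. 1 / real (Suc n)) \<longlonglongrightarrow> 0" by (rule LIMSEQ_Suc[OF lim_1_over_n])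
  have "(\<lambda>n. yosida n z) \<longlonglongrightarrow> (S (snd z), - S (fst z))"
    unfolding yosida_def using assms by (intro tendsto_intros tendsto_K e) auto
  then show ?thesis by (rule LIMSEQ_imp_Cauchy)
qed

lemma closure_D_Times: "closure (D \<times> D) = UNIV"
  by (simp add: closure_Times closure_D)

text \<open>The approximate flows are isometries. Two of them with the same initial point x differ
  by at most exp(t/2) |Y_m x - Y_n x|, which is small for x in D x D and late indices; isometry
  carries the uniform Cauchy property to all data by density. The limit is taken in the weak form,
  since for general data it need not be differentiable.\<close>

lemma free_flow_exists:
  "\<exists>p q. p 0 = p0 \<and> q 0 = q0 \<and> continuous_on {0..} p \<and> continuous_on {0..} q \<and> (\<forall>T. wave_flow 0 T p q (\<lambda>_. 0))"
proof -
  have "\<exists>Z. \<forall>n x. Z n x 0 = x \<and> (\<forall>t. (Z n x has_vector_derivative yosida n (Z n x t)) (at t))"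
    by (intro choice allI bounded_linear_ode_exists bounded_linear_yosida)
  then obtain Z where Z0: "\<And>n x. Z n x 0 = x"
    and Z: "\<And>n x t. (Z n x has_vector_derivative yosida n (Z n x t)) (at t)" by blast
  have isometry: "norm (Z n x t - Z n y t) = norm (x - y)" for n x y t
  proof -
    interpret Y: bounded_linear "yosida n" by (rule bounded_linear_yosida)
    have "norm (Z n x t - Z n y t) = norm (Z n x 0 - Z n y 0)"
      by (rule norm_const_of_skew[where y' = "\<lambda>t. yosida n (Z n x t - Z n y t)"])
        (auto simp: Y.diff yosida_skew[of n "_ - _", unfolded Y.diff] intro!: has_vector_derivative_diff Z)
    then show ?thesis by (simp add: Z0)
  qed
  have norm_Z: "norm (Z n x t) = norm x" for n x t
    using norm_const_of_skew[of "Z n x" "\<lambda>t. yosida n (Z n x t)" t] Z yosida_skew by (simp add: Z0)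
  have compare: "(norm (Z m x t - Z n x t))\<^sup>2 \<le> (norm (yosida m x - yosida n x))\<^sup>2 * exp t" if "t \<ge> 0" for m n x t
  proof -
    interpret Ym: bounded_linear "yosida m" by (rule bounded_linear_yosida)
    interpret Yn: bounded_linear "yosida n" by (rule bounded_linear_yosida)
    \<comment> \<open>The defect itself solves the flow equation of Y_n, as Y_m commutes with Y_n,
      so skewness keeps its norm at the initial value.\<close>
    have drift: "norm (yosida m (Z n x t) - yosida n (Z n x t)) = norm (yosida m x - yosida n x)" for t
    proof -
      have "norm (yosida m (Z n x t) - yosida n (Z n x t)) = norm (yosida m (Z n x 0) - yosida n (Z n x 0))"
      proof (rule norm_const_of_skew[where y' = "\<lambda>t. yosida n (yosida m (Z n x t) - yosida n (Z n x t))"])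
        fix t
        show "((\<lambda>t. yosida m (Z n x t) - yosida n (Z n x t)) has_vector_derivative
            yosida n (yosida m (Z n x t) - yosida n (Z n x t))) (at t)"
          using has_vector_derivative_diff[OF Ym.has_vector_derivative[OF Z[of n x t]] Yn.has_vector_derivative[OF Z[of n x t]]]
          by (simp add: Yn.diff yosida_commute[of m n])
      qed (rule yosida_skew)
      then show ?thesis by (simp add: Z0)
    qed
    show ?thesis
    proof (rule norm_bound_of_forced_skew[OF _ _ _ that])
      fix t
      show "((\<lambda>t. Z m x t - Z n x t) has_vector_derivative yosida m (Z m x t) - yosida n (Z n x t)) (at t)"
        by (intro has_vector_derivative_diff Z)
      \<comment> \<open>Y_m applied to the difference of the flows is orthogonal to that difference;
        splitting it off leaves a forcing of constant norm.\<close>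
      have "yosida m (Z m x t) - yosida n (Z n x t)
          = yosida m (Z m x t - Z n x t) + (yosida m (Z n x t) - yosida n (Z n x t))" by (simp add: Ym.diff)
      then have "inner (yosida m (Z m x t) - yosida n (Z n x t)) (Z m x t - Z n x t)
          = inner (yosida m (Z n x t) - yosida n (Z n x t)) (Z m x t - Z n x t)"
        by (simp only: inner_add_left yosida_skew add_0_left)
      also have "\<dots> \<le> norm (yosida m x - yosida n x) * norm (Z m x t - Z n x t)"
        using norm_cauchy_schwarz[of "yosida m (Z n x t) - yosida n (Z n x t)" "Z m x t - Z n x t"] by (simp only: drift)
      finally show "inner (yosida m (Z m x t) - yosida n (Z n x t)) (Z m x t - Z n x t)
          \<le> norm (yosida m x - yosida n x) * norm (Z m x t - Z n x t)" .
    qed (simp add: Z0)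
  qed
  define x where "x = (p0, q0)"
  have cauchy: "uniformly_Cauchy_on {0..T} (\<lambda>n. Z n x)" for T
    unfolding uniformly_Cauchy_on_def
  proof (intro allI impI)
    fix e :: real assume "e > 0"
    have "x \<in> closure (D \<times> D)" by (simp add: closure_D_Times)
    then obtain y where y: "y \<in> D \<times> D" "dist y x < e / 3" using \<open>e > 0\<close> closure_approachable
      by (metis divide_pos_pos zero_less_numeral)
    \<comment> \<open>The comparison bounds the squared norm with factor exp T, hence exp(T/2) here.
      The other two thirds of \<open>e\<close> pay for replacing \<open>x\<close> by
      \<open>y\<close> in both flows.\<close>
    have "e / 3 / exp (T / 2) > 0" using \<open>e > 0\<close> by simp
    then obtain N where N: "\<And>m n. m \<ge> N \<Longrightarrow> n \<ge> N \<Longrightarrow> norm (yosida m y - yosida n y) < e / 3 / exp (T / 2)"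
      using Cauchy_yosida[OF y(1)] unfolding Cauchy_def dist_norm by blast
    have "dist (Z m x t) (Z n x t) < e" if t: "t \<in> {0..T}" and mn: "m \<ge> N" "n \<ge> N" for t m n
    proof -
      have "(norm (Z m y t - Z n y t))\<^sup>2 \<le> (norm (yosida m y - yosida n y))\<^sup>2 * exp T"
        using compare[of t m y n] t by (smt (verit) atLeastAtMost_iff exp_le_cancel_iff mult_left_mono zero_le_power2)
      also have "\<dots> = (norm (yosida m y - yosida n y) * exp (T / 2))\<^sup>2"
        by (simp add: power_mult_distrib flip: exp_double)
      also have "\<dots> \<le> (e / 3)\<^sup>2"
        using N[OF mn] by (intro power_mono) (auto simp: field_simps)
      finally have "norm (Z m y t - Z n y t) \<le> e / 3" by (rule power2_le_imp_le) (use \<open>e > 0\<close> in simp)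
      moreover have "norm (Z k x t - Z k y t) < e / 3" for k
        using y(2) isometry[of k x t y] by (simp add: dist_norm norm_minus_commute)
      note this[of m] this[of n]
      moreover have "norm (Z m x t - Z n x t) \<le> norm (Z m x t - Z m y t) + norm (Z m y t - Z n y t) + norm (Z n x t - Z n y t)"
        using norm_triangle_ineq4[of "(Z m x t - Z m y t) + (Z m y t - Z n y t)" "Z n x t - Z n y t"]
          norm_triangle_ineq[of "Z m x t - Z m y t" "Z m y t - Z n y t"] by simp
      ultimately show ?thesis by (simp add: dist_norm)
    qed
    then show "\<exists>N. \<forall>t\<in>{0..T}. \<forall>m\<ge>N. \<forall>n\<ge>N. dist (Z m x t) (Z n x t) < e" by blast
  qed
  define z where "z t = lim (\<lambda>n. Z n x t)" for t
  have unif: "uniform_limit {0..T} (\<lambda>n. Z n x) z sequentially" for T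
    using Cauchy_uniformly_convergent[OF cauchy[of T]]
    unfolding uniformly_convergent_uniform_limit_iff z_def .
  have lim: "(\<lambda>n. Z n x t) \<longlonglongrightarrow> z t" if "t \<ge> 0" for t
    using tendsto_uniform_limitI[OF unif[of t], of t] that by simp
  have cont_Z: "continuous_on A (Z n x)" for A n
    by (meson Z has_vector_derivative_continuous continuous_at_imp_continuous_on)
  have "continuous_on {0..T} z" for T
    by (rule uniform_limit_theorem[OF _ unif]) (auto intro: always_eventually cont_Z)
  then have cont_z: "continuous_on {0..} z"
    unfolding continuous_on_eq_continuous_within
    by (metis at_within_atLeast_eq_Icc atLeastAtMost_iff atLeast_iff less_add_one less_imp_le)
  have z0: "z 0 = x" using lim[of 0] by (simp add: Z0 LIMSEQ_const_iff)
  have e: "(\<lambda>n. 1 / real (Suc n)) \<longlonglongrightarrow> 0" "\<And>n. 1 / real (Suc n) \<noteq> 0" by (rule LIMSEQ_Suc[OF lim_1_over_n]) simp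
  \<comment> \<open>Both weak equations pass to the limit in the same way: the approximate operator
    acts on the fixed test vector, where it converges to \<open>S v\<close> and is dominated by |S
    v|.\<close>
  have limit_integral: "((\<lambda>r. inner (y r) (S v)) has_integral l) {s..t}"
    if v: "v \<in> D" and s: "0 \<le> s" and y: "\<And>r. r \<ge> 0 \<Longrightarrow> (\<lambda>n. Y n r) \<longlonglongrightarrow> y r"
      and bound: "\<And>n r. norm (Y n r) \<le> norm x"
      and int: "\<And>n. ((\<lambda>r. inner (Y n r) (K (1 / Suc n) v)) has_integral l' n) {s..t}"
      and l: "l' \<longlonglongrightarrow> l" for v y Y l' l and s t :: real
  proof -
    have "norm (inner (Y n r) (K (1 / Suc n) v)) \<le> norm x * norm (S v)" for n r
    proof -
      have "norm (inner (Y n r) (K (1 / Suc n) v)) \<le> norm (Y n r) * norm (K (1 / Suc n) v)"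
        by (simp add: Cauchy_Schwarz_ineq2)
      also have "norm (K (1 / Suc n) v) \<le> norm (S v)"
        using norm_J_le[OF e(2), of n "S v"] unfolding J_S[OF e(2) v] .
      finally show ?thesis using bound[of n r]
        by (meson mult_left_mono mult_right_mono norm_ge_zero order_trans)
    qed
    moreover have "(\<lambda>n. inner (Y n r) (K (1 / Suc n) v)) \<longlonglongrightarrow> inner (y r) (S v)" if "r \<in> {s..t}" for r
      using that s by (intro tendsto_intros y tendsto_K[OF e v]) auto
    ultimately
    have *: "(\<lambda>r. inner (y r) (S v)) integrable_on {s..t}"
      "(\<lambda>n. integral {s..t} (\<lambda>r. inner (Y n r) (K (1 / Suc n) v))) \<longlonglongrightarrow> integral {s..t} (\<lambda>r. inner (y r) (S v))"
      by (rule dominated_convergence[OF has_integral_integrable[OF int] integrable_const_ivl]; blast)+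
    then have "integral {s..t} (\<lambda>r. inner (y r) (S v)) = l"
      using l LIMSEQ_unique integral_unique[OF int] by simp
    then show ?thesis using *(1) has_integral_integral by metis
  qed
  have "wave_flow 0 T (\<lambda>t. fst (z t)) (\<lambda>t. snd (z t)) (\<lambda>_. 0)" for T
    unfolding wave_flow_def
  proof (intro conjI ballI allI impI)
    show "continuous_on {0..T} (\<lambda>t. fst (z t))" "continuous_on {0..T} (\<lambda>t. snd (z t))"
      using cont_z by (auto intro!: continuous_intros elim: continuous_on_subset)
    fix v s t assume v: "v \<in> D" and st: "0 \<le> s" "s \<le> t" "t \<le> T"
    have weak: "((\<lambda>r. inner (yosida n (Z n x r)) w) has_integral inner (Z n x t - Z n x s) w) {s..t}" for n w
    proof -
      have "((\<lambda>r. yosida n (Z n x r)) has_integral Z n x t - Z n x s) {s..t}"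
        using st(2) Z has_vector_derivative_at_within by (intro fundamental_theorem_of_calculus) blast+
      from has_integral_linear[OF this bounded_linear_inner_left, of w] show ?thesis by (simp add: o_def)
    qed
    show "((\<lambda>r. inner (snd (z r)) (S v)) has_integral inner (fst (z t) - fst (z s)) v) {s..t}"
    proof (rule limit_integral[OF v st(1)])
      show "norm (snd (Z n x r)) \<le> norm x" for n r 
        using norm_snd_le[where x = "fst (Z n x r)" and y = "snd (Z n x r)"] norm_Z by simp
      show "((\<lambda>r. inner (snd (Z n x r)) (K (1 / Suc n) v)) has_integral inner (fst (Z n x t) - fst (Z n x s)) v) {s..t}" for n
        using weak[of n "(v, 0)"] by (simp add: yosida_def inner_prod_def K_sym[OF e(2)] del: of_nat_Suc)
    qed (use st in \<open>intro tendsto_intros lim; simp\<close>)+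
    have "((\<lambda>r. inner (fst (z r)) (S v)) has_integral - inner (snd (z t) - snd (z s)) v) {s..t}"
    proof (rule limit_integral[OF v st(1)])
      show "norm (fst (Z n x r)) \<le> norm x" for n r 
        using norm_fst_le[where x = "fst (Z n x r)" and y = "snd (Z n x r)"] norm_Z by simp
      show "((\<lambda>r. inner (fst (Z n x r)) (K (1 / Suc n) v)) has_integral - inner (snd (Z n x t) - snd (Z n x s)) v) {s..t}" for n
        using has_integral_neg[OF weak[of n "(0, v)"]] by (simp add: yosida_def inner_prod_def K_sym[OF e(2)] del: of_nat_Suc)
    qed (use st in \<open>intro tendsto_intros lim; simp\<close>)+
    from has_integral_neg[OF this]
    show "((\<lambda>r. inner 0 v - inner (fst (z r)) (S v)) has_integral inner (snd (z t) - snd (z s)) v) {s..t}" by simp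
  qed
  moreover have "continuous_on {0..} (\<lambda>t. fst (z t))" "continuous_on {0..} (\<lambda>t. snd (z t))"
    using cont_z by (auto intro!: continuous_intros)
  ultimately show ?thesis using z0 unfolding x_def
    by (intro exI[of _ "\<lambda>t. fst (z t)"] exI[of _ "\<lambda>t. snd (z t)"]) auto
qed

text \<open>The flow supplies only p and q, so the displacement is rebuilt by integrating the
  velocity. The time-integrated weak equation p' = S q is then exactly <S v, w> = <v, p>, and the
  adjoint criterion puts w into \<open>D\<close> with S w = p.\<close>

lemma weak_sol_exists_banach:
  assumes w0: "w0 \<in> D"
  shows "\<exists>w w'. weak_sol D S (\<lambda>_ _. 0) w w' w0 w1"
proof -
  obtain p q where pq: "p 0 = S w0" "q 0 = w1" "continuous_on {0..} p" "continuous_on {0..} q"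
    and flow: "\<And>T. wave_flow 0 T p q (\<lambda>_. 0)" using free_flow_exists by metis
  define w where "w t = w0 + integral {0..t} q" for t
  have cont: "continuous_on {0..t} q" for t using pq(4) by (rule continuous_on_subset) auto
  have *: "inner (S v) (w t) = inner v (p t)" if v: "v \<in> D" and "t \<ge> 0" for v t
  proof -
    have "(q has_integral integral {0..t} q) {0..t}"
      by (intro integrable_integral integrable_continuous_real cont)
    from has_integral_linear[OF this bounded_linear_inner_left, of "S v"]
    have "((\<lambda>r. inner (q r) (S v)) has_integral inner (integral {0..t} q) (S v)) {0..t}" by (simp add: o_def)
    moreover have "((\<lambda>r. inner (q r) (S v)) has_integral inner (p t - p 0) v) {0..t}"
      using flow[of t] that unfolding wave_flow_def by auto
    ultimately have "inner (integral {0..t} q) (S v) = inner (p t - p 0) v" by (rule has_integral_unique)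
    then show ?thesis using S_sym[OF v w0] by (simp add: w_def pq(1) inner_simps inner_commute)
  qed
  have w: "w t \<in> D" "S (w t) = p t" if "t \<ge> 0" for t
    using adjoint_characterization[OF *] that by auto
  have "weak_sol D S (\<lambda>_ _. 0) w q w0 w1" unfolding weak_sol_def
  proof (intro conjI allI impI ballI)
    show "w 0 = w0" by (simp add: w_def)
    show "continuous_on {0..} (\<lambda>t. S (w t))"
      using pq(3) by (subst continuous_on_cong[OF refl, of _ _ p]) (auto simp: w)
    fix t :: real assume t: "t \<ge> 0"
    have "((\<lambda>u. integral {0..u} q) has_vector_derivative q t) (at t within {0..t+1})"
      using t by (intro integral_has_vector_derivative cont) auto
    then show "(w has_vector_derivative q t) (at t within {0..})"
      using t by (simp add: w_def[abs_def] at_within_atLeast_eq_Icc[of 0 t "t+1"] has_vector_derivative_add_const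
          add.commute[of w0])
  next
    fix v t assume "v \<in> D" and t: "t \<ge> (0::real)"
    then have "((\<lambda>r. inner 0 v - inner (p r) (S v)) has_integral inner (q t - q 0) v) {0..t}"
      using flow[of t] unfolding wave_flow_def by auto
    then show "((\<lambda>s. - inner (S (w s)) (S v) - inner 0 v) has_integral inner (q t) v - inner w1 v) {0..t}"
      by (subst has_integral_cong[of _ _ "\<lambda>r. inner 0 v - inner (p r) (S v)"]) (auto simp: w pq inner_diff_left)
  qed (use w pq in auto)
  then show ?thesis by blast
qed

end

text \<open>A space of sort \<open>{real_inner, complete_space}\<close> is a Banach space, but its type is not of class
\<open>banach\<close>, which the vector-valued analysis above needs; its isomorphic copy is.\<close>

typedef 'a banach_copy = "UNIV :: 'a set" by simp

setup_lifting type_definition_banach_copy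

instantiation banach_copy :: (real_inner) real_inner
begin

lift_definition zero_banach_copy :: "'a banach_copy" is 0 .
lift_definition plus_banach_copy :: "'a banach_copy \<Rightarrow> 'a banach_copy \<Rightarrow> 'a banach_copy" is "(+)" .
lift_definition minus_banach_copy :: "'a banach_copy \<Rightarrow> 'a banach_copy \<Rightarrow> 'a banach_copy" is "(-)" .
lift_definition uminus_banach_copy :: "'a banach_copy \<Rightarrow> 'a banach_copy" is uminus .
lift_definition scaleR_banach_copy :: "real \<Rightarrow> 'a banach_copy \<Rightarrow> 'a banach_copy" is "(*\<^sub>R)" .
lift_definition sgn_banach_copy :: "'a banach_copy \<Rightarrow> 'a banach_copy" is sgn .
lift_definition norm_banach_copy :: "'a banach_copy \<Rightarrow> real" is norm .
lift_definition dist_banach_copy :: "'a banach_copy \<Rightarrow> 'a banach_copy \<Rightarrow> real" is dist .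
lift_definition inner_banach_copy :: "'a banach_copy \<Rightarrow> 'a banach_copy \<Rightarrow> real" is inner .

definition uniformity_banach_copy :: "('a banach_copy \<times> 'a banach_copy) filter" where
  "uniformity_banach_copy = (INF e\<in>{0<..}. principal {(x, y). dist x y < e})"

definition open_banach_copy :: "'a banach_copy set \<Rightarrow> bool" where
  "open_banach_copy U \<longleftrightarrow> (\<forall>x\<in>U. \<forall>\<^sub>F (x', y) in uniformity. x' = x \<longrightarrow> y \<in> U)"

instance
proof
  fix x y z :: "'a banach_copy" and a b :: real and U :: "'a banach_copy set"
  show "x + y + z = x + (y + z)" by transfer (rule add.assoc)
  show "x + y = y + x" by transfer (rule add.commute)
  show "0 + x = x" by transfer simp
  show "- x + x = 0" by transfer simp
  show "x - y = x + - y" by transfer simp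
  show "a *\<^sub>R (x + y) = a *\<^sub>R x + a *\<^sub>R y" by transfer (rule scaleR_add_right)
  show "(a + b) *\<^sub>R x = a *\<^sub>R x + b *\<^sub>R x" by transfer (rule scaleR_add_left)
  show "a *\<^sub>R b *\<^sub>R x = (a * b) *\<^sub>R x" by transfer simp
  show "1 *\<^sub>R x = x" by transfer simp
  show "sgn x = inverse (norm x) *\<^sub>R x" by transfer (rule sgn_div_norm)
  show "dist x y = norm (x - y)" by transfer (rule dist_norm)
  show "inner x y = inner y x" by transfer (rule inner_commute)
  show "inner (x + y) z = inner x z + inner y z" by transfer (rule inner_add_left)
  show "inner (a *\<^sub>R x) y = a * inner x y" by transfer simp
  show "0 \<le> inner x x" by transfer simp
  show "inner x x = 0 \<longleftrightarrow> x = 0" by transfer simp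
  show "norm x = sqrt (inner x x)" by transfer (rule norm_eq_sqrt_inner)
qed (fact uniformity_banach_copy_def open_banach_copy_def)+

end

instance banach_copy :: ("{real_inner, complete_space}") banach
proof
  fix X :: "nat \<Rightarrow> 'a banach_copy" assume "Cauchy X"
  then have "Cauchy (\<lambda>n. Rep_banach_copy (X n))"
    by (simp add: Cauchy_def dist_banach_copy.rep_eq)
  then obtain l where "(\<lambda>n. Rep_banach_copy (X n)) \<longlonglongrightarrow> l"
    using Cauchy_convergent_iff convergent_def by blast
  then have "X \<longlonglongrightarrow> Abs_banach_copy l"
    by (simp add: lim_sequentially dist_banach_copy.rep_eq Abs_banach_copy_inverse)
  then show "convergent X" by (rule convergentI)
qed

lemma bounded_linear_Rep_banach_copy: "bounded_linear Rep_banach_copy"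
  by (rule bounded_linear_intro[of _ 1])
    (simp_all add: plus_banach_copy.rep_eq scaleR_banach_copy.rep_eq norm_banach_copy.rep_eq)

context self_adjoint
begin

lemma self_adjoint_banach_copy:
  "self_adjoint_op {x. Rep_banach_copy x \<in> D} (\<lambda>x. Abs_banach_copy (S (Rep_banach_copy x)))"
    (is "self_adjoint_op ?D ?S")
proof -
  note [simp] = Abs_banach_copy_inverse
  have inner_simp: "inner x y = inner (Rep_banach_copy x) (Rep_banach_copy y)" for x y :: "'h banach_copy"
    by (rule inner_banach_copy.rep_eq)
  note linear = subspace_add[OF subspace_D] subspace_scale[OF subspace_D] subspace_0[OF subspace_D]
  have "linear_on_dom ?D ?S" unfolding linear_on_dom_def subspace_def
    by (auto simp: linear plus_banach_copy.rep_eq scaleR_banach_copy.rep_eq zero_banach_copy.rep_eq S_add S_scale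
        simp flip: Rep_banach_copy_inject)
  moreover have "closure ?D = UNIV"
  proof -
    have "x \<in> closure ?D" for x
    proof (clarsimp simp: closure_approachable)
      fix e :: real assume "e > 0"
      then obtain y where "y \<in> D" "dist y (Rep_banach_copy x) < e"
        using closure_D closure_approachable[of "Rep_banach_copy x" D] by auto
      then show "\<exists>y. Rep_banach_copy y \<in> D \<and> dist y x < e"
        by (intro exI[of _ "Abs_banach_copy y"]) (simp add: dist_banach_copy.rep_eq)
    qed
    then show ?thesis by blast
  qed
  moreover have "adjoint_dom ?D ?S = ?D"
  proof (intro set_eqI iffI)
    fix y assume "y \<in> adjoint_dom ?D ?S"
    then obtain z where z: "\<And>x. x \<in> ?D \<Longrightarrow> inner (?S x) y = inner x z" by (auto simp: adjoint_dom_def)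
    have "inner (S v) (Rep_banach_copy y) = inner v (Rep_banach_copy z)" if "v \<in> D" for v
      using z[of "Abs_banach_copy v"] that by (simp add: inner_simp)
    from adjoint_characterization(1)[OF this] show "y \<in> ?D" by simp
  next
    fix y assume "y \<in> ?D"
    then show "y \<in> adjoint_dom ?D ?S" unfolding adjoint_dom_def
      by (auto simp: inner_simp S_sym intro!: exI[of _ "?S y"])
  qed
  moreover have "\<forall>x\<in>?D. \<forall>y\<in>?D. inner (?S x) y = inner x (?S y)" by (simp add: inner_simp S_sym)
  ultimately show ?thesis unfolding self_adjoint_op_def by blast
qed

lemma weak_sol_exists:
  assumes "w0 \<in> D"
  shows "\<exists>w w'. weak_sol D S (\<lambda>_ _. 0) w w' w0 w1"
proof -
  let ?R = "Rep_banach_copy :: 'h banach_copy \<Rightarrow> 'h" and ?A = "Abs_banach_copy :: 'h \<Rightarrow> 'h banach_copy"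
  interpret c: self_adjoint_banach "{x. ?R x \<in> D}" "\<lambda>x. ?A (S (?R x))"
    by unfold_locales (rule self_adjoint_banach_copy)
  interpret R: bounded_linear ?R by (rule bounded_linear_Rep_banach_copy)
  note [simp] = Abs_banach_copy_inverse
  obtain w w' where w: "weak_sol {x. ?R x \<in> D} (\<lambda>x. ?A (S (?R x))) (\<lambda>_ _. 0) w w' (?A w0) (?A w1)"
    using c.weak_sol_exists_banach[of "?A w0" "?A w1"] assms by auto
  have "weak_sol D S (\<lambda>_ _. 0) (\<lambda>t. ?R (w t)) (\<lambda>t. ?R (w' t)) w0 w1"
    unfolding weak_sol_def
  proof (intro conjI allI impI ballI)
    show "continuous_on {0..} (\<lambda>t. S (?R (w t)))"
      using w R.continuous_on[of "{0..}" "\<lambda>t. ?A (S (?R (w t)))"] by (simp add: weak_sol_def)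
    show "continuous_on {0..} (\<lambda>t. ?R (w' t))"
      using w by (intro R.continuous_on) (simp add: weak_sol_def)
    fix t :: real assume t: "t \<ge> 0"
    show "((\<lambda>t. ?R (w t)) has_vector_derivative ?R (w' t)) (at t within {0..})"
      using w t by (intro R.has_vector_derivative) (simp add: weak_sol_def)
  next
    fix v and t :: real assume v: "v \<in> D" and t: "t \<ge> 0"
    have "((\<lambda>s. - inner (?A (S (?R (w s)))) (?A (S (?R (?A v)))) - inner 0 (?A v)) has_integral
        inner (w' t) (?A v) - inner (?A w1) (?A v)) {0..t}"
      using w v t unfolding weak_sol_def by (elim conjE) (drule bspec[of _ _ "?A v"], simp_all)
    then show "((\<lambda>s. - inner (S (?R (w s))) (S v) - inner 0 v) has_integral inner (?R (w' t)) v - inner w1 v) {0..t}"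
      by (simp add: inner_banach_copy.rep_eq)
  qed (use w in \<open>auto simp: weak_sol_def\<close>)
  then show ?thesis by blast
qed

end

section \<open>Energy estimates on damped and anti-damped intervals\<close>

text \<open>Sign and size of the forcing are known inside an interval; at its right end the feedback
  has already switched. Endpoints have measure zero, so an interior comparison suffices.\<close>

lemma has_integral_le_interior:
  fixes f g :: "real \<Rightarrow> real"
  assumes "(f has_integral i) {a..b}" "(g has_integral j) {a..b}" "\<And>x. x \<in> {a<..<b} \<Longrightarrow> f x \<le> g x"
  shows "i \<le> j"
proof (rule has_integral_le[of f i "{a<..<b}" g j])
  show "(f has_integral i) {a<..<b}" "(g has_integral j) {a<..<b}"
    using has_integral_open_interval[of f i a b] has_integral_open_interval[of g j a b] assms(1,2) by simp_all
qed (rule assms(3))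

text \<open>Pairing with x = Bs y gives |Bs y|^2 \<le> |B| |Bs y| |y|. Applied to differences, the
  bound transfers continuity of the control operators to their adjoints.\<close>

lemma norm_adjoint_le:
  fixes B :: "'u::real_inner \<Rightarrow>\<^sub>L 'h::real_inner" and Bs :: "'h \<Rightarrow>\<^sub>L 'u"
  assumes "\<And>x y. inner (B x) y = inner x (Bs y)"
  shows "norm Bs \<le> norm B"
proof (rule norm_blinfun_bound)
  fix y
  have "norm (Bs y) * norm (Bs y) = inner (B (Bs y)) y" by (simp add: assms dot_square_norm power2_eq_square)
  also have "\<dots> \<le> norm (B (Bs y)) * norm y" by (rule norm_cauchy_schwarz)
  also have "\<dots> \<le> (norm B * norm (Bs y)) * norm y" by (intro mult_right_mono norm_blinfun) simp
  finally have "norm (Bs y) * norm (Bs y) \<le> (norm B * norm y) * norm (Bs y)" by (simp add: mult_ac)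
  then show "norm (Bs y) \<le> norm B * norm y" by (cases "Bs y = 0") auto
qed simp

text \<open>The extension \<open>g\<close> agrees with \<open>B\<close> except possibly at the right
  end, where \<open>B\<close> may jump. It provides continuity inside and a bound on everything but
  that end.\<close>

lemma feedback_regular:
  fixes B :: "real \<Rightarrow> ('u::real_inner \<Rightarrow>\<^sub>L 'h::real_inner)" and Bs :: "real \<Rightarrow> ('h \<Rightarrow>\<^sub>L 'u)"
  assumes adj: "\<And>s x y. s \<in> {a..<b} \<Longrightarrow> inner (B s x) y = inner x (Bs s y)"
    and reg: "C0_on_closed a b B" and q: "continuous_on {a..b} q"
  shows "continuous_on {a<..<b} (\<lambda>s. B s (Bs s (q s)))" "bounded ((\<lambda>s. B s (Bs s (q s))) ` {a..<b})"
proof -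
  obtain g where g: "\<And>s. s \<in> {a..<b} \<Longrightarrow> g s = B s" "continuous_on {a..b} g"
    using reg unfolding C0_on_closed_def by blast
  have B: "continuous_on {a<..<b} B"
  proof (rule continuous_on_eq)
    show "continuous_on {a<..<b} g" using g(2) by (rule continuous_on_subset) auto
  qed (use g(1) in auto)
  have dist: "dist (Bs s) (Bs r) \<le> dist (B s) (B r)" if "s \<in> {a<..<b}" "r \<in> {a<..<b}" for s r
    unfolding dist_norm using adj that
    by (intro norm_adjoint_le) (auto simp: blinfun.diff_left inner_diff_left inner_diff_right)
  have Bs: "continuous_on {a<..<b} Bs"
    unfolding continuous_on_iff
  proof (intro ballI allI impI)
    fix x e assume x: "x \<in> {a<..<b}" and e: "0 < (e::real)"
    then obtain d where "d > 0" "\<And>s. s \<in> {a<..<b} \<Longrightarrow> dist s x < d \<Longrightarrow> dist (B s) (B x) < e"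
      using B unfolding continuous_on_iff by blast
    then show "\<exists>d>0. \<forall>s\<in>{a<..<b}. dist s x < d \<longrightarrow> dist (Bs s) (Bs x) < e"
      using dist x by (meson le_less_trans)
  qed
  have "continuous_on {a<..<b} q" using q by (rule continuous_on_subset) auto
  then show "continuous_on {a<..<b} (\<lambda>s. B s (Bs s (q s)))"
    by (intro blinfun.continuous_on B Bs)
  obtain Mg where Mg: "\<And>s. s \<in> {a..b} \<Longrightarrow> norm (g s) \<le> Mg"
    using compact_imp_bounded[OF compact_continuous_image[OF g(2) compact_Icc]] unfolding bounded_iff by blast
  obtain Mq where Mq: "\<And>s. s \<in> {a..b} \<Longrightarrow> norm (q s) \<le> Mq"
    using compact_imp_bounded[OF compact_continuous_image[OF q compact_Icc]] unfolding bounded_iff by blast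
  have "norm (B s (Bs s (q s))) \<le> Mg * (Mg * Mq)" if s: "s \<in> {a..<b}" for s
  proof -
    have BM: "norm (B s) \<le> Mg" using Mg[of s] g(1)[OF s] s by simp
    then have BsM: "norm (Bs s) \<le> Mg" using norm_adjoint_le[of "B s" "Bs s"] adj[OF s] by (meson order_trans)
    have M: "0 \<le> Mg" using BM norm_ge_zero order_trans by blast
    have "norm (Bs s (q s)) \<le> Mg * Mq"
      using norm_blinfun[of "Bs s" "q s"] mult_mono[OF BsM Mq[of s] M] s by auto
    then show ?thesis
      using norm_blinfun[of "B s" "Bs s (q s)"] mult_mono[OF BM _ M] by (meson norm_ge_zero order_trans)
  qed
  then show "bounded ((\<lambda>s. B s (Bs s (q s))) ` {a..<b})" unfolding bounded_iff by blast
qed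

context self_adjoint
begin

text \<open>The equation for p = S u is obtained by differentiating <u, S v> = <S u, v> in time; S u
  itself need not be differentiable.\<close>

lemma weak_sol_wave_flow:
  assumes sol: "weak_sol D S G u u' u0 u1" and "0 \<le> a"
  shows "wave_flow a b (\<lambda>t. S (u t)) u' (\<lambda>t. - G t (u' t))"
  unfolding wave_flow_def
proof (intro conjI ballI allI impI)
  show "continuous_on {a..b} (\<lambda>t. S (u t))" "continuous_on {a..b} u'"
    using sol \<open>0 \<le> a\<close> unfolding weak_sol_def by (auto elim!: continuous_on_subset)
  fix v s t assume v: "v \<in> D" and st: "a \<le> s" "s \<le> t" "t \<le> b"
  have "((\<lambda>r. inner (u' r) (S v)) has_integral inner (u t) (S v) - inner (u s) (S v)) {s..t}"
  proof (rule fundamental_theorem_of_calculus[OF st(2)])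
    fix r assume r: "r \<in> {s..t}"
    then have "(u has_vector_derivative u' r) (at r within {s..t})"
      using sol st \<open>0 \<le> a\<close> unfolding weak_sol_def
      by (elim conjE) (rule has_vector_derivative_within_subset[of u "u' r" r "{0..}"], auto)
    then show "((\<lambda>r. inner (u r) (S v)) has_vector_derivative inner (u' r) (S v)) (at r within {s..t})"
      by (rule bounded_linear.has_vector_derivative[OF bounded_linear_inner_left])
  qed
  moreover have "inner (u r) (S v) = inner (S (u r)) v" if "r \<ge> 0" for r
    using S_sym[of "u r" v] v sol that by (simp add: weak_sol_def)
  ultimately show "((\<lambda>r. inner (u' r) (S v)) has_integral inner (S (u t) - S (u s)) v) {s..t}"
    using st \<open>0 \<le> a\<close> by (simp add: inner_diff_left)
  let ?h = "\<lambda>r. - inner (S (u r)) (S v) - inner (G r (u' r)) v"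
  have int: "(?h has_integral inner (u' r) v - inner u1 v) {0..r}" if "r \<ge> 0" for r
    using sol v that unfolding weak_sol_def by blast
  have st0: "0 \<le> s" "0 \<le> t" using st \<open>0 \<le> a\<close> by auto
  then have "?h integrable_on {s..t}"
    using integrable_subinterval_real[OF has_integral_integrable[OF int[of t]], of s t] st(2) by auto
  then obtain i where i: "(?h has_integral i) {s..t}" by blast
  \<comment> \<open>The weak formulation integrates from 0 only; additivity at \<open>s\<close>
    isolates the part over [s, t].\<close>
  have "(?h has_integral (inner (u' s) v - inner u1 v) + i) {0..t}"
    by (rule has_integral_combine[OF st0(1) st(2) int[OF st0(1)] i])
  from has_integral_unique[OF int[OF st0(2)] this]
  have i_eq: "i = inner (u' t - u' s) v" by (simp add: inner_diff_left)
  show "((\<lambda>r. inner (- G r (u' r)) v - inner (S (u r)) (S v)) has_integral inner (u' t - u' s) v) {s..t}"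
    by (rule has_integral_eq[OF _ i[unfolded i_eq]]) simp
qed

lemma wave_flow_shift:
  assumes flow: "wave_flow 0 T p q f"
  shows "wave_flow a (a + T) (\<lambda>t. p (t - a)) (\<lambda>t. q (t - a)) (\<lambda>t. f (t - a))"
  unfolding wave_flow_def
proof (intro conjI ballI allI impI)
  have c: "continuous_on {0..T} p" "continuous_on {0..T} q" using flow by (auto simp: wave_flow_def)
  show "continuous_on {a..a + T} (\<lambda>t. p (t - a))" "continuous_on {a..a + T} (\<lambda>t. q (t - a))"
    by (rule continuous_on_compose2[OF c(1)] continuous_on_compose2[OF c(2)], auto intro!: continuous_intros)+
  fix v s t assume "v \<in> D" and st: "a \<le> s" "s \<le> t" "t \<le> a + T"
  then have
    "((\<lambda>r. inner (q r) (S v)) has_integral inner (p (t - a) - p (s - a)) v) {s - a..t - a}"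
    "((\<lambda>r. inner (f r) v - inner (p r) (S v)) has_integral inner (q (t - a) - q (s - a)) v) {s - a..t - a}"
    using flow unfolding wave_flow_def by (auto simp: algebra_simps)
  from this[THEN has_integral_shift_real_ivl, of "- a"]
  show
    "((\<lambda>r. inner (q (r - a)) (S v)) has_integral inner (p (t - a) - p (s - a)) v) {s..t}"
    "((\<lambda>r. inner (f (r - a)) v - inner (p (r - a)) (S v)) has_integral inner (q (t - a) - q (s - a)) v) {s..t}"
    by simp_all
qed

abbreviation energy :: "(real \<Rightarrow> 'h) \<Rightarrow> (real \<Rightarrow> 'h) \<Rightarrow> real \<Rightarrow> real" where
  "energy p q t \<equiv> ((norm (p t))\<^sup>2 + (norm (q t))\<^sup>2) / 2"

lemma energy_identity_subinterval:
  assumes flow: "wave_flow a b p q f" and f: "continuous_on {a<..<b} f" "bounded (f ` {a..b})"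
    and st: "a \<le> s" "s \<le> t" "t \<le> b"
  shows "((\<lambda>r. inner (f r) (q r)) has_integral (energy p q t - energy p q s)) {s..t}"
proof (rule energy_identity[OF wave_flow_subinterval[OF flow] st(2)])
  show "continuous_on {s<..<t} f" using f(1) by (rule continuous_on_subset) (use st in auto)
  show "bounded (f ` {s..t})" using f(2) by (rule bounded_subset) (use st in auto)
qed (use st in auto)

lemma energy_mono:
  assumes "wave_flow a b p q f" "continuous_on {a<..<b} f" "bounded (f ` {a..b})"
    and "a \<le> s" "s \<le> t" "t \<le> b" and "\<And>r. r \<in> {a<..<b} \<Longrightarrow> inner (f r) (q r) \<ge> 0"
  shows "energy p q s \<le> energy p q t"
  using has_integral_le_interior[OF has_integral_0 energy_identity_subinterval[OF assms(1-6)]] assms(4-7) by force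

lemma energy_antimono:
  assumes "wave_flow a b p q f" "continuous_on {a<..<b} f" "bounded (f ` {a..b})"
    and "a \<le> s" "s \<le> t" "t \<le> b" and "\<And>r. r \<in> {a<..<b} \<Longrightarrow> inner (f r) (q r) \<le> 0"
  shows "energy p q t \<le> energy p q s"
  using has_integral_le_interior[OF energy_identity_subinterval[OF assms(1-6)] has_integral_0] assms(4-7) by force

lemma energy_growth:
  assumes flow: "wave_flow a b p q f" and f: "continuous_on {a<..<b} f" "bounded (f ` {a..b})" and "a \<le> b"
    and le: "\<And>r. r \<in> {a<..<b} \<Longrightarrow> inner (f r) (q r) \<le> k * energy p q r"
  shows "energy p q b \<le> exp (k * (b - a)) * energy p q a"
proof -
  have c: "continuous_on {a..b} p" "continuous_on {a..b} q" using flow by (auto simp: wave_flow_def)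
  define \<phi> where "\<phi> t = energy p q t * exp (- (k * t))" for t
  have "\<phi> b \<le> \<phi> a"
  proof (rule DERIV_nonpos_imp_decreasing_open[OF \<open>a \<le> b\<close>])
    show "continuous_on {a..b} \<phi>" unfolding \<phi>_def by (intro continuous_intros c) simp
    fix x assume "a < x" "x < b"
    \<comment> \<open>The energy identity on all subintervals is a weak integral equation in the
      real line, so the energy is differentiable inside although p and q need not be.\<close>
    have "(energy p q has_vector_derivative inner (f x) (q x)) (at x)"
    proof (rule has_vector_derivative_of_weak_integral[of a b])
      fix v s t :: real assume "a \<le> s" "s \<le> t" "t \<le> b"
      from has_integral_mult_left[OF energy_identity_subinterval[OF flow f this], of v]
      show "((\<lambda>r. inner (inner (f r) (q r)) v) has_integral inner (energy p q t - energy p q s) v) {s..t}" by simp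
    next
      have "continuous_on {a<..<b} q" using c(2) by (rule continuous_on_subset) auto
      then show "continuous_on {a<..<b} (\<lambda>r. inner (f r) (q r))" using f(1) by (intro continuous_intros)
    qed (use \<open>a < x\<close> \<open>x < b\<close> in auto)
    then have d: "(energy p q has_real_derivative inner (f x) (q x)) (at x)"
      by (simp add: has_real_derivative_iff_has_vector_derivative)
    have "((\<lambda>t. exp (- (k * t))) has_real_derivative - k * exp (- (k * x))) (at x)"
      by (auto intro!: derivative_eq_intros)
    from DERIV_mult[OF d this]
    have "(\<phi> has_real_derivative inner (f x) (q x) * exp (- (k * x)) + - k * exp (- (k * x)) * energy p q x) (at x)"
      unfolding \<phi>_def .
    moreover have "r * e + - k * e * n = (r - k * n) * e" for r e n :: real by algebra
    then have "inner (f x) (q x) * exp (- (k * x)) + - k * exp (- (k * x)) * energy p q x \<le> 0"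
      using le[of x] \<open>a < x\<close> \<open>x < b\<close> by (simp only:) (intro mult_nonpos_nonneg, auto)
    ultimately show "\<exists>y. (\<phi> has_real_derivative y) (at x) \<and> y \<le> 0" by blast
  qed
  then have "energy p q b * exp (- (k * b)) * exp (k * b) \<le> energy p q a * exp (- (k * a)) * exp (k * b)"
    unfolding \<phi>_def by (intro mult_right_mono) auto
  then show ?thesis
    unfolding mult.assoc exp_add[symmetric] by (simp add: algebra_simps)
qed

text \<open>The comparison with the free solution runs over the whole interval, but observability is
  used only on an initial window of length \<open>T\<close>; thus one constant \<open>c\<close>
  serves all damped intervals at least that long.\<close>

lemma energy_decay_damped:
  fixes \<iota> :: "'h \<Rightarrow> 'w::real_inner" and B :: "real \<Rightarrow> ('u::real_inner \<Rightarrow>\<^sub>L 'h)" and Bs :: "real \<Rightarrow> ('h \<Rightarrow>\<^sub>L 'u)"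
  assumes flow: "wave_flow a b (\<lambda>t. S (u t)) q f"
    and f: "continuous_on {a<..<b} f" "bounded (f ` {a..b})"
    and f_eq: "\<And>r. r \<in> {a<..<b} \<Longrightarrow> f r = - B r (Bs r (q r))"
    and adj: "\<And>r x y. r \<in> {a<..<b} \<Longrightarrow> inner (B r x) y = inner x (Bs r y)"
    and lower: "\<And>r x. r \<in> {a<..<b} \<Longrightarrow> m * (norm (\<iota> x))\<^sup>2 \<le> (norm (Bs r x))\<^sup>2"
    and upper: "\<And>r x. r \<in> {a<..<b} \<Longrightarrow> (norm (Bs r x))\<^sup>2 \<le> M * (norm (\<iota> x))\<^sup>2"
    and m: "0 < m" "m \<le> M" and \<iota>: "bounded_linear \<iota>" "\<And>x. (norm (\<iota> x))\<^sup>2 \<le> C * (norm x)\<^sup>2" and C: "0 \<le> C"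
    and T: "0 \<le> T" "T \<le> b - a" and c: "0 < c" and ua: "u a \<in> D"
    and obs: "\<And>w w' w0 w1. weak_sol D S (\<lambda>_ _. 0) w w' w0 w1 \<Longrightarrow>
      ((norm (S w0))\<^sup>2 + (norm w1)\<^sup>2) / 2 \<le> c * integral {0..T} (\<lambda>s. (norm (\<iota> (w' s)))\<^sup>2)"
  defines "E \<equiv> energy (\<lambda>t. S (u t)) q" and "L \<equiv> 2 * c * (1 + 4 * C\<^sup>2 * (b - a)\<^sup>2 * M\<^sup>2)"
  shows "E b \<le> L / (m + L) * E a"
proof -
  interpret \<iota>: bounded_linear \<iota> by fact
  have ab: "a \<le> b" and M: "0 < M" using T m by auto
  obtain w w' where w: "weak_sol D S (\<lambda>_ _. 0) w w' (u a) (q a)" using weak_sol_exists[OF ua] by blast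
  define qw where "qw t = w' (t - a)" for t
  define qz where "qz t = q t - qw t" for t
  define pz where "pz t = S (u t) - S (w (t - a))" for t
  have "wave_flow a (a + (b - a)) (\<lambda>t. S (w (t - a))) (\<lambda>t. w' (t - a)) (\<lambda>t. - 0)"
    by (rule wave_flow_shift[OF weak_sol_wave_flow[OF w order_refl]])
  then have flow_w: "wave_flow a b (\<lambda>t. S (w (t - a))) qw (\<lambda>t. 0)" by (simp add: qw_def[abs_def])
  have flow_z: "wave_flow a b pz qz f"
    using wave_flow_diff[OF flow flow_w] by (simp add: pz_def[abs_def] qz_def[abs_def])
  have cont: "continuous_on {a..b} q" "continuous_on {a..b} qw" "continuous_on {a..b} qz"
    using flow flow_w flow_z by (auto simp: wave_flow_def)
  note cont' = this[THEN \<iota>.continuous_on]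
  define X where "X = integral {a..b} (\<lambda>r. (norm (\<iota> (q r)))\<^sup>2)"
  define Y where "Y = integral {a..b} (\<lambda>r. norm (\<iota> (q r)) * norm (\<iota> (qz r)))"
  define Z where "Z = integral {a..b} (\<lambda>r. (norm (\<iota> (qz r)))\<^sup>2)"
  have X: "((\<lambda>r. (norm (\<iota> (q r)))\<^sup>2) has_integral X) {a..b}"
    and Y: "((\<lambda>r. norm (\<iota> (q r)) * norm (\<iota> (qz r))) has_integral Y) {a..b}"
    and Z: "((\<lambda>r. (norm (\<iota> (qz r)))\<^sup>2) has_integral Z) {a..b}"
    unfolding X_def Y_def Z_def
    by (intro integrable_integral integrable_continuous_real continuous_intros cont')+
  have X0: "0 \<le> X" using X by (rule has_integral_nonneg) simp
  have diss: "m * X \<le> E a - E b"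
  proof -
    have "((\<lambda>r. - inner (f r) (q r)) has_integral - (E b - E a)) {a..b}"
      unfolding E_def by (intro has_integral_neg energy_identity_subinterval[OF flow f] order_refl ab)
    from has_integral_le_interior[OF has_integral_mult_right[OF X, of m] this]
    have "m * X \<le> - (E b - E a)"
      using lower by (simp add: f_eq adj dot_square_norm)
    then show ?thesis by simp
  qed
  \<comment> \<open>z starts from zero data, so its energy at \<open>t\<close> is the work of the
    feedback up to \<open>t\<close>, at most M Y by Cauchy-Schwarz in the control space and the
    upper bound for \<open>Bs\<close>. The factor 2 C passes from the energy to the norm of
    \<iota>.\<close>
  have z_bound: "(norm (\<iota> (qz t)))\<^sup>2 \<le> 2 * C * (M * Y)" if t: "t \<in> {a..b}" for t
  proof -
    have "pz a = 0" "qz a = 0" using w by (auto simp: pz_def qz_def qw_def weak_sol_def)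
    then have "((\<lambda>r. inner (f r) (qz r)) has_integral energy pz qz t) {a..t}"
      using energy_identity_subinterval[OF flow_z f, of a t] t by simp
    moreover have int: "(\<lambda>r. norm (\<iota> (q r)) * norm (\<iota> (qz r))) integrable_on {a..t}"
      using integrable_subinterval_real[OF has_integral_integrable[OF Y], of a t] t by auto
    have "((\<lambda>r. M * (norm (\<iota> (q r)) * norm (\<iota> (qz r)))) has_integral
        M * integral {a..t} (\<lambda>r. norm (\<iota> (q r)) * norm (\<iota> (qz r)))) {a..t}"
      by (intro has_integral_mult_right integrable_integral int)
    moreover have "inner (f r) (qz r) \<le> M * (norm (\<iota> (q r)) * norm (\<iota> (qz r)))" if "r \<in> {a<..<t}" for r
    proof -
      have r: "r \<in> {a<..<b}" using that t by auto
      have "inner (f r) (qz r) \<le> norm (Bs r (q r)) * norm (Bs r (qz r))"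
        using norm_cauchy_schwarz[of "- Bs r (q r)" "Bs r (qz r)"] by (simp add: f_eq[OF r] adj[OF r])
      moreover have "(norm (Bs r (q r)) * norm (Bs r (qz r)))\<^sup>2 \<le> (M * (norm (\<iota> (q r)) * norm (\<iota> (qz r))))\<^sup>2"
        using mult_mono[OF upper[OF r, of "q r"] upper[OF r, of "qz r"]] M
        by (simp add: power_mult_distrib power2_eq_square[of M] mult_ac)
      then have "norm (Bs r (q r)) * norm (Bs r (qz r)) \<le> M * (norm (\<iota> (q r)) * norm (\<iota> (qz r)))"
        by (rule power2_le_imp_le) (use M in simp)
      ultimately show ?thesis by simp
    qed
    ultimately have "energy pz qz t \<le> M * integral {a..t} (\<lambda>r. norm (\<iota> (q r)) * norm (\<iota> (qz r)))"
      by (rule has_integral_le_interior)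
    also have "\<dots> \<le> M * Y"
      unfolding Y_def using t M int has_integral_integrable[OF Y]
      by (intro mult_left_mono integral_subset_le) auto
    finally have "(norm (pz t))\<^sup>2 + (norm (qz t))\<^sup>2 \<le> 2 * (M * Y)" by simp
    then have "(norm (qz t))\<^sup>2 \<le> 2 * (M * Y)" using zero_le_power2[of "norm (pz t)"] by linarith
    then have "C * (norm (qz t))\<^sup>2 \<le> C * (2 * (M * Y))" using C by (rule mult_left_mono)
    then show ?thesis using \<iota>(2)[of "qz t"] by (simp add: mult_ac)
  qed
  \<comment> \<open>Integrating \<open>z_bound\<close> contributes the factor b - a; k^2 is the term
    4 C^2 (b - a)^2 M^2 in \<open>L\<close>.\<close>
  define k where "k = 2 * C * M * (b - a)"
  have "Z \<le> k * Y"
  proof -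
    have "((\<lambda>_. 2 * C * (M * Y)) has_integral (b - a) * (2 * C * (M * Y))) {a..b}"
      using has_integral_const_real[of "2 * C * (M * Y)" a b] ab by simp
    from has_integral_le[OF Z this z_bound] show ?thesis by (simp add: k_def mult_ac)
  qed
  \<comment> \<open>Young's inequality is weighted so that Z / 2 reappears and can be absorbed,
    leaving Z \<le> k^2 X.\<close>
  also have "k * Y \<le> (k\<^sup>2 * X + Z) / 2"
  proof (rule has_integral_le[OF has_integral_mult_right[OF Y]])
    show "((\<lambda>r. (k\<^sup>2 * (norm (\<iota> (q r)))\<^sup>2 + (norm (\<iota> (qz r)))\<^sup>2) / 2) has_integral (k\<^sup>2 * X + Z) / 2) {a..b}"
      by (intro has_integral_divide has_integral_add has_integral_mult_right X Z)
    fix r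
    show "k * (norm (\<iota> (q r)) * norm (\<iota> (qz r))) \<le> (k\<^sup>2 * (norm (\<iota> (q r)))\<^sup>2 + (norm (\<iota> (qz r)))\<^sup>2) / 2"
      using sum_squares_bound[of "k * norm (\<iota> (q r))" "norm (\<iota> (qz r))"] by (simp add: power_mult_distrib mult_ac)
  qed
  finally have ZX: "Z \<le> k\<^sup>2 * X" by simp
  have "E a \<le> c * integral {0..T} (\<lambda>s. (norm (\<iota> (w' s)))\<^sup>2)"
    using obs[OF w] by (simp add: E_def)
  also have "integral {0..T} (\<lambda>s. (norm (\<iota> (w' s)))\<^sup>2) = integral {a..a + T} (\<lambda>s. (norm (\<iota> (qw s)))\<^sup>2)"
    using integral_shift_real_ivl[of a a "a + T" "\<lambda>s. (norm (\<iota> (qw s)))\<^sup>2"] by (simp add: qw_def)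
  also have "\<dots> \<le> 2 * X + 2 * Z"
  proof (rule order_trans)
    have int: "(\<lambda>s. (norm (\<iota> (qw s)))\<^sup>2) integrable_on {a..b}"
      by (intro integrable_continuous_real continuous_intros cont')
    then show "integral {a..a + T} (\<lambda>s. (norm (\<iota> (qw s)))\<^sup>2) \<le> integral {a..b} (\<lambda>s. (norm (\<iota> (qw s)))\<^sup>2)"
      using T integrable_subinterval_real[OF int, of a "a + T"] by (intro integral_subset_le) auto
    show "integral {a..b} (\<lambda>s. (norm (\<iota> (qw s)))\<^sup>2) \<le> 2 * X + 2 * Z"
    proof (rule has_integral_le[OF integrable_integral[OF int]])
      show "((\<lambda>r. 2 * (norm (\<iota> (q r)))\<^sup>2 + 2 * (norm (\<iota> (qz r)))\<^sup>2) has_integral 2 * X + 2 * Z) {a..b}"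
        by (intro has_integral_add has_integral_mult_right X Z)
      fix r
      have "norm (\<iota> (qw r)) \<le> norm (\<iota> (q r)) + norm (\<iota> (qz r))"
        using norm_triangle_ineq4[of "\<iota> (q r)" "\<iota> (qz r)"] by (simp add: qz_def \<iota>.diff)
      then have "(norm (\<iota> (qw r)))\<^sup>2 \<le> (norm (\<iota> (q r)) + norm (\<iota> (qz r)))\<^sup>2" by (rule power_mono) simp
      also have "\<dots> \<le> 2 * (norm (\<iota> (q r)))\<^sup>2 + 2 * (norm (\<iota> (qz r)))\<^sup>2"
        using sum_squares_bound[of "norm (\<iota> (q r))" "norm (\<iota> (qz r))"] by (simp add: power2_sum)
      finally show "(norm (\<iota> (qw r)))\<^sup>2 \<le> 2 * (norm (\<iota> (q r)))\<^sup>2 + 2 * (norm (\<iota> (qz r)))\<^sup>2" .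
    qed
  qed
  also have "\<dots> \<le> 2 * (1 + k\<^sup>2) * X" using ZX by (simp add: algebra_simps)
  finally have "E a \<le> c * (2 * (1 + k\<^sup>2) * X)" using c by simp
  then have "E a \<le> L * X"
  proof -
    have "k\<^sup>2 = 4 * C\<^sup>2 * (b - a)\<^sup>2 * M\<^sup>2" unfolding k_def by algebra
    with \<open>E a \<le> c * (2 * (1 + k\<^sup>2) * X)\<close> show ?thesis by (simp add: L_def mult_ac)
  qed
  moreover have L: "0 < L" using c by (simp add: L_def add_pos_nonneg)
  ultimately have "m * E a \<le> L * (m * X)" using m(1) by (simp add: mult.left_commute)
  also have "\<dots> \<le> L * (E a - E b)" using diss L by simp
  finally have "m * E a \<le> L * E a - L * E b" by (simp add: algebra_simps)
  \<comment> \<open>Weakening \<open>E a\<close> to \<open>E b\<close> on the left produces L / (m +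
    L), which is always positive; the sharper factor 1 - m / L need not be, and a logarithm is taken
    later.\<close>
  moreover have "m * E b \<le> m * E a"
  proof -
    have "0 \<le> m * X" using m(1) X0 by simp
    then have "E b \<le> E a" using diss by linarith
    then show ?thesis using m(1) by simp
  qed
  ultimately have "(m + L) * E b \<le> L * E a" by (simp add: algebra_simps)
  then show ?thesis using m(1) L by (simp add: field_simps)
qed

end

section \<open>From interval estimates to decay in time\<close>

lemma C1_on_closed_imp_C0: "C1_on_closed a b f \<Longrightarrow> C0_on_closed a b f"
  unfolding C1_on_closed_def C0_on_closed_def
  by (meson continuous_on_eq_continuous_within has_vector_derivative_continuous)

text \<open>The bound by the larger of two sampled values is what a falling piece followed by a
  rising one provides; it carries decay at the sampling times over to all times.\<close>

lemma tendsto_zero_of_interlaced_bounds: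
  fixes E :: "real \<Rightarrow> real" and s :: "nat \<Rightarrow> real"
  assumes lim: "(\<lambda>n. E (s n)) \<longlonglongrightarrow> 0" and s: "s 0 = 0" "mono s" "\<And>x. \<exists>n. x < s n"
    and E: "\<And>t. 0 \<le> E t" "\<And>n t. s n \<le> t \<Longrightarrow> t \<le> s (Suc n) \<Longrightarrow> E t \<le> max (E (s n)) (E (s (Suc n)))"
  shows "(E \<longlongrightarrow> 0) at_top"
proof (rule tendstoI)
  fix e :: real assume "e > 0"
  from order_tendstoD(2)[OF lim this] obtain N where N: "\<And>n. n \<ge> N \<Longrightarrow> E (s n) < e"
    by (auto simp: eventually_sequentially)
  have "E t < e" if t: "t \<ge> s N" for t
  proof -
    \<comment> \<open>The least such index brackets \<open>t\<close> between \<open>s n\<close> and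
      \<open>s (Suc n)\<close>; monotonicity gives n \<ge> N, so both ends are small.\<close>
    define n where "n = (LEAST n. t < s (Suc n))"
    have "\<exists>n. t < s (Suc n)" using s(3)[of t] monoD[OF s(2), of _ "Suc _"] by (metis le_SucI order_less_le_trans order_refl)
    then have n1: "t < s (Suc n)" unfolding n_def by (rule LeastI_ex)
    then have "s N < s (Suc n)" using t by simp
    then have "N \<le> n" using monoD[OF s(2), of "Suc n" N] by (meson not_less not_less_eq_eq)
    have "s n \<le> t"
    proof (cases n)
      case 0
      then show ?thesis using t s(1) monoD[OF s(2), of 0 N] by simp
    next
      case (Suc k)
      then have "\<not> t < s (Suc k)" unfolding n_def by (intro not_less_Least) simp
      then show ?thesis using Suc by simp
    qed
    then have "E t \<le> max (E (s n)) (E (s (Suc n)))" using n1 by (intro E(2)) auto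
    also have "\<dots> < e" using N[of n] N[of "Suc n"] \<open>N \<le> n\<close> by simp
    finally show ?thesis .
  qed
  then show "\<forall>\<^sub>F t in at_top. dist (E t) 0 < e"
    unfolding eventually_at_top_linorder using E(1) by (auto simp: abs_of_nonneg)
qed

text \<open>Iteration multiplies the factors, and their product is the exponential of the partial
  sums of the series; positivity of \<rho> permits the logarithm.\<close>

lemma tendsto_zero_of_product_bound:
  fixes E \<beta> \<rho> :: "nat \<Rightarrow> real"
  assumes step: "\<And>n. E (Suc n) \<le> exp (\<beta> n) * (\<rho> n * E n)" and E: "\<And>n. 0 \<le> E n" and \<rho>: "\<And>n. 0 < \<rho> n"
    and series: "filterlim (\<lambda>N. \<Sum>n<N. \<beta> n + ln (\<rho> n)) at_bot sequentially"
  shows "E \<longlonglongrightarrow> 0"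
proof -
  have bound: "E N \<le> exp (\<Sum>n<N. \<beta> n + ln (\<rho> n)) * E 0" for N
  proof (induction N)
    case (Suc N)
    have "E (Suc N) \<le> exp (\<beta> N) * (\<rho> N * E N)" by (rule step)
    also have "\<dots> = exp (\<beta> N + ln (\<rho> N)) * E N" using \<rho>[of N] by (simp add: exp_add)
    also have "\<dots> \<le> exp (\<beta> N + ln (\<rho> N)) * (exp (\<Sum>n<N. \<beta> n + ln (\<rho> n)) * E 0)"
      using Suc by (intro mult_left_mono) auto
    finally show ?case by (simp add: exp_add mult_ac)
  qed simp
  have "(\<lambda>N. exp (\<Sum>n<N. \<beta> n + ln (\<rho> n)) * E 0) \<longlonglongrightarrow> 0"
    using tendsto_mult_left_zero[OF filterlim_compose[OF exp_at_bot series], of "E 0"] by simp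
  then show ?thesis
    by (rule tendsto_sandwich[OF _ _ tendsto_const, rotated -1]) (use bound E in \<open>auto intro: always_eventually\<close>)
qed

theorem theorem4p7:
  fixes DA :: "'h::{real_inner,complete_space} set" and A :: "'h \<Rightarrow> 'h"
    and DV :: "'h set" and S :: "'h \<Rightarrow> 'h"
    and B1 :: "real \<Rightarrow> ('u1::{real_inner,complete_space} \<Rightarrow>\<^sub>L 'h)"
    and B1s :: "real \<Rightarrow> ('h \<Rightarrow>\<^sub>L 'u1)"
    and B3 :: "real \<Rightarrow> ('u3::{real_inner,complete_space} \<Rightarrow>\<^sub>L 'h)"
    and B3s :: "real \<Rightarrow> ('h \<Rightarrow>\<^sub>L 'u3)"
    and \<iota>1 :: "'h \<Rightarrow> 'w1::{real_inner,complete_space}"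
    and \<iota>3 :: "'h \<Rightarrow> 'w3::{real_inner,complete_space}"
    and C1 C3 :: real and tt :: "nat \<Rightarrow> real" and m M :: "nat \<Rightarrow> real"
    and Tbar c :: real
    and u u' :: "real \<Rightarrow> 'h" and u0 u1 :: 'h
  assumes A_sa: "self_adjoint_op DA A"
    and A_pos: "positive_op DA A"
    and A_coer: "coercive_op DA A"
    and S_sqrt: "is_op_sqrt DA A DV S"
    and B1_adj: "\<forall>s\<ge>0. \<forall>x y. inner (blinfun_apply (B1 s) x) y = inner x (blinfun_apply (B1s s) y)"
    and B3_adj: "\<forall>s\<ge>0. \<forall>x y. inner (blinfun_apply (B3 s) x) y = inner x (blinfun_apply (B3s s) y)"
    and W1: "bounded_linear \<iota>1" "\<forall>x. (norm (\<iota>1 x))\<^sup>2 \<le> C1 * (norm x)\<^sup>2"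
    and W3: "bounded_linear \<iota>3" "\<forall>x. (norm (\<iota>3 x))\<^sup>2 \<le> C3 * (norm x)\<^sup>2"
    and t0: "tt 0 = 0" and t_mono: "strict_mono tt"
    and B3_zero: "\<forall>n. \<forall>s\<in>{tt (2*n)..<tt (2*n+1)}. B3 s = 0"
    and B1_zero: "\<forall>n. \<forall>s\<in>{tt (2*n+1)..<tt (2*n+2)}. B1 s = 0"
    and B1_reg: "\<forall>n. C1_on_closed (tt (2*n)) (tt (2*n+1)) B1"
    and B3_reg: "\<forall>n. C0_on_closed (tt (2*n+1)) (tt (2*n+2)) B3"
    and cond_j: "\<forall>n. 0 < m (2*n) \<and> m (2*n) \<le> M (2*n) \<and>
        (\<forall>s\<in>{tt (2*n)..<tt (2*n+1)}. \<forall>x.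
           m (2*n) * (norm (\<iota>1 x))\<^sup>2 \<le> (norm (blinfun_apply (B1s s) x))\<^sup>2 \<and>
           (norm (blinfun_apply (B1s s) x))\<^sup>2 \<le> M (2*n) * (norm (\<iota>1 x))\<^sup>2)"
    and cond_jj: "\<forall>n. 0 < M (2*n+1) \<and>
        (\<forall>s\<in>{tt (2*n+1)..<tt (2*n+2)}. \<forall>x.
           (norm (blinfun_apply (B3s s) x))\<^sup>2 \<le> M (2*n+1) * (norm (\<iota>3 x))\<^sup>2)"
    and obs: "Tbar > 0 \<and> (\<forall>T>Tbar. \<exists>c>0. \<forall>w w' w0 w1.
        weak_sol DV S (\<lambda>_ _. 0) w w' w0 w1 \<longrightarrow>
        ((norm (S w0))\<^sup>2 + (norm w1)\<^sup>2) / 2 \<le> c * integral {0..T} (\<lambda>s. (norm (\<iota>1 (w' s)))\<^sup>2))"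
    and Tstar: "(INF n. tt (2*n+1) - tt (2*n)) > Tbar"
    and c_obs: "c > 0 \<and> (\<forall>w w' w0 w1.
        weak_sol DV S (\<lambda>_ _. 0) w w' w0 w1 \<longrightarrow>
        ((norm (S w0))\<^sup>2 + (norm w1)\<^sup>2) / 2
          \<le> c * integral {0..(INF n. tt (2*n+1) - tt (2*n))} (\<lambda>s. (norm (\<iota>1 (w' s)))\<^sup>2))"
    and series: "filterlim (\<lambda>N. \<Sum>n<N.
        2 * C3 * M (2*n+1) * (tt (2*n+2) - tt (2*n+1))
        + ln (2 * c * (1 + 4 * C1\<^sup>2 * (tt (2*n+1) - tt (2*n))\<^sup>2 * (M (2*n))\<^sup>2)
              / (m (2*n) + 2 * c * (1 + 4 * C1\<^sup>2 * (tt (2*n+1) - tt (2*n))\<^sup>2 * (M (2*n))\<^sup>2))))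
        at_bot sequentially"
    and sol: "weak_sol DV S
        (\<lambda>s x. blinfun_apply (B1 s) (blinfun_apply (B1s s) x) - blinfun_apply (B3 s) (blinfun_apply (B3s s) x))
        u u' u0 u1"
  shows "((\<lambda>t. ((norm (S (u t)))\<^sup>2 + (norm (u' t))\<^sup>2) / 2) \<longlongrightarrow> 0) at_top"
proof (cases "\<exists>x::'h. x \<noteq> 0")
  case False
  then have "S (u t) = 0" "u' t = 0" for t by blast+
  then show ?thesis by simp
next
  case True
  \<comment> \<open>A nonzero vector forces the embedding constants to be nonnegative. On the zero
    space their sign is undetermined, but there the energy vanishes.\<close>
  then obtain x :: 'h where "x \<noteq> 0" by blast
  then have C: "0 \<le> C1" "0 \<le> C3"
    using order_trans[OF zero_le_power2 W1(2)[rule_format, of x]] order_trans[OF zero_le_power2 W3(2)[rule_format, of x]]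
    by (simp_all add: zero_le_mult_iff)
  interpret self_adjoint DV S using S_sqrt by unfold_locales (simp add: is_op_sqrt_def)
  define T where "T = (INF n. tt (2 * n + 1) - tt (2 * n))"
  have lt: "tt i < tt j" if "i < j" for i j using t_mono that by (simp add: strict_mono_def)
  have le: "tt i \<le> tt j" if "i \<le> j" for i j using t_mono that by (simp add: strict_mono_less_eq)
  have nonneg: "0 \<le> tt i" for i using le[of 0 i] t0 by simp
  have T: "0 < T" "T \<le> tt (2 * n + 1) - tt (2 * n)" for n
  proof -
    show "0 < T" using Tstar obs by (simp add: T_def)
    have "bdd_below (range (\<lambda>n. tt (2 * n + 1) - tt (2 * n)))"
      by (rule bdd_belowI[of _ 0]) (auto intro!: le)
    then show "T \<le> tt (2 * n + 1) - tt (2 * n)" unfolding T_def by (rule cINF_lower) simp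
  qed
  define f where "f t = - (B1 t (B1s t (u' t)) - B3 t (B3s t (u' t)))" for t
  define E where "E = energy (\<lambda>t. S (u t)) u'"
  have flow: "wave_flow (tt i) (tt j) (\<lambda>t. S (u t)) u' f" for i j
    using weak_sol_wave_flow[OF sol nonneg] by (simp add: f_def[abs_def])
  have cont: "continuous_on {tt i..tt j} u'" for i j using flow[of i j] by (simp add: wave_flow_def)
  have even_f: "f r = - B1 r (B1s r (u' r))" if "r \<in> {tt (2 * n)..<tt (2 * n + 1)}" for r n
    using B3_zero that by (simp add: f_def)
  have odd_f: "f r = B3 r (B3s r (u' r))" if "r \<in> {tt (2 * n + 1)..<tt (2 * n + 2)}" for r n
    using B1_zero that by (simp add: f_def)
  have adj1: "inner (B1 r x) y = inner x (B1s r y)" and adj3: "inner (B3 r x') y = inner x' (B3s r y)"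
    if "r \<in> {tt i..<tt j}" for r i j x x' y
    using B1_adj B3_adj that nonneg[of i] by auto
  have regular: "continuous_on {a<..<b} f" "bounded (f ` {a..b})"
    if "continuous_on {a<..<b} g" "bounded (g ` {a..<b})" "\<And>r. r \<in> {a..<b} \<Longrightarrow> f r = g r"
    for a b :: real and g
  proof -
    show "continuous_on {a<..<b} f" using that(1) by (rule continuous_on_eq) (use that(3) in auto)
    \<comment> \<open>At the right end \<open>f\<close> already follows the next regime; one extra
      value does not affect boundedness.\<close>
    have "{a..b} \<subseteq> insert b {a..<b}" by auto
    then have "f ` {a..b} \<subseteq> insert (f b) (f ` {a..<b})" by blast
    also have "f ` {a..<b} = g ` {a..<b}" by (rule image_cong[OF refl that(3)])
    finally have "f ` {a..b} \<subseteq> insert (f b) (g ` {a..<b})" .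
    then show "bounded (f ` {a..b})" using that(2) by (metis bounded_insert bounded_subset)
  qed
  have even_reg: "continuous_on {tt (2 * n)<..<tt (2 * n + 1)} f" "bounded (f ` {tt (2 * n)..tt (2 * n + 1)})" for n
  proof -
    note fr = feedback_regular[OF adj1[where i = "2 * n" and j = "2 * n + 1"] C1_on_closed_imp_C0[OF B1_reg[rule_format]] cont]
    have c: "continuous_on {tt (2 * n)<..<tt (2 * n + 1)} (\<lambda>r. - B1 r (B1s r (u' r)))"
      by (intro continuous_on_minus fr(1))
    have b: "bounded ((\<lambda>r. - B1 r (B1s r (u' r))) ` {tt (2 * n)..<tt (2 * n + 1)})"
      using fr(2) by (simp add: bounded_iff)
    show "continuous_on {tt (2 * n)<..<tt (2 * n + 1)} f" "bounded (f ` {tt (2 * n)..tt (2 * n + 1)})"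
      using regular[OF c b even_f[where n = n]] by simp_all
  qed
  have odd_reg: "continuous_on {tt (2 * n + 1)<..<tt (2 * n + 2)} f" "bounded (f ` {tt (2 * n + 1)..tt (2 * n + 2)})" for n
  proof -
    note fr = feedback_regular[OF adj3[where i = "2 * n + 1" and j = "2 * n + 2"] B3_reg[rule_format] cont]
    show "continuous_on {tt (2 * n + 1)<..<tt (2 * n + 2)} f" "bounded (f ` {tt (2 * n + 1)..tt (2 * n + 2)})"
      using regular[OF fr odd_f[where n = n]] by simp_all
  qed
  have even_sign: "inner (f r) (u' r) \<le> 0" if "r \<in> {tt (2 * n)<..<tt (2 * n + 1)}" for r n
    using even_f[of r n] adj1[of r "2 * n" "2 * n + 1"] that by simp
  have odd_eq: "inner (f r) (u' r) = (norm (B3s r (u' r)))\<^sup>2" if "r \<in> {tt (2 * n + 1)<..<tt (2 * n + 2)}" for r n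
    using odd_f[of r n] adj3[of r "2 * n + 1" "2 * n + 2"] that by (simp add: dot_square_norm)
  define L where "L n = 2 * c * (1 + 4 * C1\<^sup>2 * (tt (2*n+1) - tt (2*n))\<^sup>2 * (M (2*n))\<^sup>2)" for n
  have m: "0 < m (2 * n)" for n using cond_j by auto
  have L: "0 < L n" for n using c_obs by (simp add: L_def add_pos_nonneg)
  have decay: "E (tt (2 * n + 1)) \<le> L n / (m (2 * n) + L n) * E (tt (2 * n))" for n
    unfolding E_def L_def
  proof (rule energy_decay_damped[OF flow even_reg, where \<iota> = \<iota>1 and B = B1 and Bs = B1s and T = T])
    show "u (tt (2 * n)) \<in> DV" using sol nonneg[of "2 * n"] by (simp add: weak_sol_def)
  qed (use cond_j adj1[where i = "2 * n" and j = "2 * n + 1"] even_f[of _ n] W1 C T(1) T(2)[of n] c_obs in \<open>auto simp: T_def less_imp_le\<close>)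
  have growth: "E (tt (2 * n + 2)) \<le> exp (2 * C3 * M (2*n+1) * (tt (2*n+2) - tt (2*n+1))) * E (tt (2 * n + 1))" for n
    unfolding E_def
  proof (rule energy_growth[OF flow odd_reg])
    fix r assume r: "r \<in> {tt (2 * n + 1)<..<tt (2 * n + 2)}"
    have M: "0 < M (2 * n + 1)" using cond_jj by blast
    have "inner (f r) (u' r) \<le> M (2 * n + 1) * (norm (\<iota>3 (u' r)))\<^sup>2"
      unfolding odd_eq[OF r] using cond_jj r by auto
    also have "\<dots> \<le> M (2 * n + 1) * (C3 * (norm (u' r))\<^sup>2)" using W3(2) M by (intro mult_left_mono) auto
    \<comment> \<open>|u'|^2 is at most twice the energy, the origin of the factor 2 in the growth
      exponent.\<close>
    also have "\<dots> \<le> M (2 * n + 1) * (C3 * (2 * energy (\<lambda>t. S (u t)) u' r))"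
      using C M by (intro mult_left_mono) auto
    also have "\<dots> = 2 * C3 * M (2 * n + 1) * energy (\<lambda>t. S (u t)) u' r" by (simp only: mult_ac)
    finally show "inner (f r) (u' r) \<le> 2 * C3 * M (2 * n + 1) * energy (\<lambda>t. S (u t)) u' r" .
  qed (rule le, simp)
  have E0: "0 \<le> E t" for t by (simp add: E_def)
  have lim: "(\<lambda>n. E (tt (2 * n))) \<longlonglongrightarrow> 0"
  proof (rule tendsto_zero_of_product_bound)
    show "E (tt (2 * Suc n)) \<le> exp (2 * C3 * M (2*n+1) * (tt (2*n+2) - tt (2*n+1))) * (L n / (m (2 * n) + L n) * E (tt (2 * n)))" for n
    proof -
      have "exp (2 * C3 * M (2*n+1) * (tt (2*n+2) - tt (2*n+1))) * E (tt (2 * n + 1))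
          \<le> exp (2 * C3 * M (2*n+1) * (tt (2*n+2) - tt (2*n+1))) * (L n / (m (2 * n) + L n) * E (tt (2 * n)))"
        by (rule mult_left_mono[OF decay]) simp
      from order_trans[OF growth this] show ?thesis by (simp only: mult_Suc_right add.commute[of 2])
    qed
    show "0 < L n / (m (2 * n) + L n)" for n using L[of n] m[of n] by simp
    show "filterlim (\<lambda>N. \<Sum>n<N. 2 * C3 * M (2*n+1) * (tt (2*n+2) - tt (2*n+1)) + ln (L n / (m (2 * n) + L n))) at_bot sequentially"
      using series unfolding L_def .
  qed (rule E0)
  have "(E \<longlongrightarrow> 0) at_top"
  proof (rule tendsto_zero_of_interlaced_bounds[where s = "\<lambda>n. tt (2 * n)", OF lim])
    show "mono (\<lambda>n. tt (2 * n))" by (intro monoI le) simp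
    show "\<exists>n. x < tt (2 * n)" for x
    proof -
      \<comment> \<open>The damped intervals alone, each of length at least \<open>T\<close>, push
        the switching times to infinity.\<close>
      have "real n * T \<le> tt (2 * n)" for n
      proof (induction n)
        case (Suc n)
        then show ?case using T(2)[of n] le[of "2 * n + 1" "2 * Suc n"] by (simp add: algebra_simps)
      qed (simp add: t0)
      moreover obtain n :: nat where "x < real n * T" using T(1) reals_Archimedean3 by blast
      ultimately show ?thesis using order_less_le_trans by blast
    qed
    fix n t assume t: "tt (2 * n) \<le> t" "t \<le> tt (2 * Suc n)"
    show "E t \<le> max (E (tt (2 * n))) (E (tt (2 * Suc n)))"
    proof (cases "t \<le> tt (2 * n + 1)")
      case True
      have "E t \<le> E (tt (2 * n))" unfolding E_def
        by (rule energy_antimono[OF flow even_reg order_refl t(1) True even_sign])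
      then show ?thesis by simp
    next
      case False
      have "E t \<le> E (tt (2 * n + 2))" unfolding E_def
        by (rule energy_mono[OF flow odd_reg]) (use False t odd_eq in auto)
      then show ?thesis by simp
    qed
  qed (simp_all add: t0 E0)
  then show ?thesis by (simp add: E_def)
qed

end
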